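(* Let $\mathcal{H}$ be a Hilbert space, $\Lambda$ an index set, $q=\{q_{\alpha\beta}\in\mathbb{T}:\alpha\ne\beta\in\Lambda\}$ with $q_{\alpha\beta}=q_{\beta\alpha}^{-1}$, and $\mathcal{T}=\{T_\alpha:\alpha\in\Lambda\}$ a family of contractions on $\mathcal{H}$ with $T_\alpha T_\beta=q_{\alpha\beta}T_\beta T_\alpha$ for all $\alpha\ne\beta$. Suppose one of the following holds: (1) every $T_\alpha$ is an isometry; (2) additionally $T_\alpha T_\beta^*=\overline{q_{\alpha\beta}}\,T_\beta^*T_\alpha$ for all $\alpha\ne\beta$; (3) $\Lambda$ is countable and $\sum_{\alpha\in\Lambda}\|T_\alpha\|^2\le1$. Then there exist a Hilbert space $\mathcal{K}\supseteq\mathcal{H}$ and unitaries $\{U_\alpha:\alpha\in\Lambda\}$ on $\mathcal{K}$ with $U_\alpha U_\beta=q_{\alpha\beta}U_\beta U_\alpha$ for all $\alpha\ne\beta$ such that \[ T_{\alpha_1}^{m_{\alpha_1}}\cdots T_{\alpha_k}^{m_{\alpha_k}}=P_{\mathcal{H}}U_{\alpha_1}^{m_{\alpha_1}}\cdots U_{\alpha_k}^{m_{\alpha_k}}|_{\mathcal{H}} \] for every $k$, all distinct $\alpha_1,\dots,\alpha_k\in\Lambda$ and all $m_{\alpha_1},\dots,m_{\alpha_k}\in\mathbb{N}\cup\{0\}$.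
   Context: $P_{\mathcal{H}}$ denotes the orthogonal projection of $\mathcal{K}$ onto $\mathcal{H}$. *)

theory Defs
  imports "HOL-Analysis.Analysis"
begin

text \<open>Complex Hilbert spaces are represented explicitly as a carrier set inside an
  ambient type together with the vector operations and the inner product
  (inner product linear in the second argument).\<close>

record 'a chs =
  hs_carrier :: "'a set"
  hs_add :: "'a \<Rightarrow> 'a \<Rightarrow> 'a"
  hs_zero :: "'a"
  hs_scale :: "complex \<Rightarrow> 'a \<Rightarrow> 'a"
  hs_inner :: "'a \<Rightarrow> 'a \<Rightarrow> complex"

definition hs_minus :: "'a chs \<Rightarrow> 'a \<Rightarrow> 'a \<Rightarrow> 'a" where
  "hs_minus S x y = hs_add S x (hs_scale S (-1) y)"

definition hs_norm :: "'a chs \<Rightarrow> 'a \<Rightarrow> real" where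
  "hs_norm S x = sqrt (Re (hs_inner S x x))"

definition chs_hilbert :: "'a chs \<Rightarrow> bool" where
  "chs_hilbert S \<longleftrightarrow>
     hs_zero S \<in> hs_carrier S \<and>
     (\<forall>x\<in>hs_carrier S. \<forall>y\<in>hs_carrier S. hs_add S x y \<in> hs_carrier S) \<and>
     (\<forall>a. \<forall>x\<in>hs_carrier S. hs_scale S a x \<in> hs_carrier S) \<and>
     (\<forall>x\<in>hs_carrier S. \<forall>y\<in>hs_carrier S. \<forall>z\<in>hs_carrier S.
        hs_add S (hs_add S x y) z = hs_add S x (hs_add S y z)) \<and>
     (\<forall>x\<in>hs_carrier S. \<forall>y\<in>hs_carrier S. hs_add S x y = hs_add S y x) \<and>
     (\<forall>x\<in>hs_carrier S. hs_add S x (hs_zero S) = x) \<and>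
     (\<forall>x\<in>hs_carrier S. hs_add S x (hs_scale S (-1) x) = hs_zero S) \<and>
     (\<forall>a b. \<forall>x\<in>hs_carrier S. hs_scale S a (hs_scale S b x) = hs_scale S (a * b) x) \<and>
     (\<forall>x\<in>hs_carrier S. hs_scale S 1 x = x) \<and>
     (\<forall>a. \<forall>x\<in>hs_carrier S. \<forall>y\<in>hs_carrier S.
        hs_scale S a (hs_add S x y) = hs_add S (hs_scale S a x) (hs_scale S a y)) \<and>
     (\<forall>a b. \<forall>x\<in>hs_carrier S.
        hs_scale S (a + b) x = hs_add S (hs_scale S a x) (hs_scale S b x)) \<and>
     (\<forall>x\<in>hs_carrier S. \<forall>y\<in>hs_carrier S. hs_inner S x y = cnj (hs_inner S y x)) \<and>
     (\<forall>x\<in>hs_carrier S. \<forall>y\<in>hs_carrier S. \<forall>z\<in>hs_carrier S.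
        hs_inner S x (hs_add S y z) = hs_inner S x y + hs_inner S x z) \<and>
     (\<forall>a. \<forall>x\<in>hs_carrier S. \<forall>y\<in>hs_carrier S.
        hs_inner S x (hs_scale S a y) = a * hs_inner S x y) \<and>
     (\<forall>x\<in>hs_carrier S. Re (hs_inner S x x) \<ge> 0) \<and>
     (\<forall>x\<in>hs_carrier S. hs_inner S x x = 0 \<longrightarrow> x = hs_zero S) \<and>
     (\<forall>s :: nat \<Rightarrow> 'a. (\<forall>n. s n \<in> hs_carrier S) \<and>
          (\<forall>e>0. \<exists>N. \<forall>m\<ge>N. \<forall>n\<ge>N. hs_norm S (hs_minus S (s m) (s n)) < e) \<longrightarrow>
          (\<exists>x\<in>hs_carrier S. \<forall>e>0. \<exists>N. \<forall>n\<ge>N. hs_norm S (hs_minus S (s n) x) < e))"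

definition hs_linear :: "'a chs \<Rightarrow> 'b chs \<Rightarrow> ('a \<Rightarrow> 'b) \<Rightarrow> bool" where
  "hs_linear S R T \<longleftrightarrow>
     (\<forall>x\<in>hs_carrier S. T x \<in> hs_carrier R) \<and>
     (\<forall>x\<in>hs_carrier S. \<forall>y\<in>hs_carrier S. T (hs_add S x y) = hs_add R (T x) (T y)) \<and>
     (\<forall>a. \<forall>x\<in>hs_carrier S. T (hs_scale S a x) = hs_scale R a (T x))"

definition chs_contraction :: "'a chs \<Rightarrow> ('a \<Rightarrow> 'a) \<Rightarrow> bool" where
  "chs_contraction S T \<longleftrightarrow> hs_linear S S T \<and> (\<forall>x\<in>hs_carrier S. hs_norm S (T x) \<le> hs_norm S x)"

definition chs_isometry :: "'a chs \<Rightarrow> ('a \<Rightarrow> 'a) \<Rightarrow> bool" where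
  "chs_isometry S T \<longleftrightarrow> hs_linear S S T \<and> (\<forall>x\<in>hs_carrier S. hs_norm S (T x) = hs_norm S x)"

definition chs_unitary :: "'a chs \<Rightarrow> ('a \<Rightarrow> 'a) \<Rightarrow> bool" where
  "chs_unitary S U \<longleftrightarrow> chs_isometry S U \<and> U ` hs_carrier S = hs_carrier S"

definition chs_opnorm :: "'a chs \<Rightarrow> ('a \<Rightarrow> 'a) \<Rightarrow> real" where
  "chs_opnorm S T = Sup {hs_norm S (T x) | x. x \<in> hs_carrier S \<and> hs_norm S x \<le> 1}"

text \<open>Hilbert space chs_adjoint (exists and is unique for bounded operators).\<close>
definition chs_is_adjoint :: "'a chs \<Rightarrow> ('a \<Rightarrow> 'a) \<Rightarrow> ('a \<Rightarrow> 'a) \<Rightarrow> bool" where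
  "chs_is_adjoint S T T' \<longleftrightarrow> (\<forall>y\<in>hs_carrier S. T' y \<in> hs_carrier S) \<and>
     (\<forall>x\<in>hs_carrier S. \<forall>y\<in>hs_carrier S. hs_inner S (T x) y = hs_inner S x (T' y))"

definition chs_adjoint :: "'a chs \<Rightarrow> ('a \<Rightarrow> 'a) \<Rightarrow> ('a \<Rightarrow> 'a)" where
  "chs_adjoint S T = (SOME T'. chs_is_adjoint S T T')"

definition orth_proj :: "'a chs \<Rightarrow> 'a set \<Rightarrow> 'a \<Rightarrow> 'a" where
  "orth_proj S M x = (THE y. y \<in> M \<and> (\<forall>z\<in>M. hs_inner S (hs_minus S x y) z = 0))"

text \<open>Isometric linear embedding of H into K (identifying H with a subspace of K).\<close>
definition hs_embedding :: "'a chs \<Rightarrow> 'b chs \<Rightarrow> ('a \<Rightarrow> 'b) \<Rightarrow> bool" where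
  "hs_embedding H K J \<longleftrightarrow> hs_linear H K J \<and>
     (\<forall>x\<in>hs_carrier H. \<forall>y\<in>hs_carrier H. hs_inner K (J x) (J y) = hs_inner H x y)"

definition word_op :: "('i \<Rightarrow> 'a \<Rightarrow> 'a) \<Rightarrow> ('i \<times> nat) list \<Rightarrow> 'a \<Rightarrow> 'a" where
  "word_op T ws = foldr (\<lambda>(a, m) acc. (T a ^^ m) \<circ> acc) ws id"

end

theory Submission
  imports Defs "HOL-Library.Multiset"
begin

text \<open>Write \<open>q a b = cis (2 * \<sigma> a b)\<close> with \<open>\<sigma>\<close> antisymmetric. After Weyl normalisation the products of the
  operators depend only on the multiset of their letters, and one looks for a projective unitary
  representation of the free abelian group over the letters whose compression is the regular
  dilation \<open>n \<mapsto> adjoint (T (neg n)) (T (pos n))\<close>. The corresponding kernel is positive as soon as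
  Brehmer's condition \<open>(\<Sum>v\<subseteq>S. (-1) ^ |v| * \<parallel>T v x\<parallel>\<^sup>2) \<ge> 0\<close> holds for all finite sets \<open>S\<close> of letters, because
  it decomposes into these defect forms; the dilation space is the completion of the span of the
  kernel. Brehmer's condition holds in each of the three cases: the defect forms vanish for
  isometries, they are bounded below by \<open>(1 - (\<Sum>a\<in>S. \<parallel>T a\<parallel>\<^sup>2)) * \<parallel>x\<parallel>\<^sup>2\<close> in the summable case, and for doubly commuting
  families each letter is a contraction, with adjoint, for the form of the remaining letters.\<close>

section \<open>Semi-inner product spaces and their completion\<close>

text \<open>The half angles in \<open>\<sigma>\<close> come from symmetrising products:
  \<open>cis (- \<sigma> a b)\<close> times the product of \<open>T a\<close> and \<open>T b\<close>
  is symmetric in the two letters. The obstacle is then the bookkeeping of phases: positivity of the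
  kernel requires the phase of an entry to split into a factor of the left vector and a factor of
  the right one, and the antisymmetry of \<open>\<sigma>\<close> is what makes it split. Negative
  exponents are removed by a common shift, so the kernel only contains products of the
  \<open>T a\<close>; adjoints of these operators enter only in the doubly commuting case.
  Positivity concerns finite families of vectors while Brehmer's condition concerns single vectors;
  sesquilinearity of the defect forms bridges the two. Formal sums of generators do not satisfy the
  vector space laws, hence \<open>semi_ip\<close> states its laws for \<open>B\<close> alone, and
  equality of vectors is read through \<open>B\<close>.\<close>

locale semi_ip =
  fixes V :: "'v set" and add :: "'v \<Rightarrow> 'v \<Rightarrow> 'v" and smul :: "complex \<Rightarrow> 'v \<Rightarrow> 'v"
    and B :: "'v \<Rightarrow> 'v \<Rightarrow> complex"
  assumes V_nonempty: "V \<noteq> {}"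
    and add_closed [simp, intro]: "x \<in> V \<Longrightarrow> y \<in> V \<Longrightarrow> add x y \<in> V"
    and smul_closed [simp, intro]: "x \<in> V \<Longrightarrow> smul c x \<in> V"
    and B_herm: "x \<in> V \<Longrightarrow> y \<in> V \<Longrightarrow> B x y = cnj (B y x)"
    and B_add_right: "x \<in> V \<Longrightarrow> y \<in> V \<Longrightarrow> z \<in> V \<Longrightarrow> B x (add y z) = B x y + B x z"
    and B_smul_right: "x \<in> V \<Longrightarrow> y \<in> V \<Longrightarrow> B x (smul c y) = c * B x y"
    and B_nonneg: "x \<in> V \<Longrightarrow> 0 \<le> Re (B x x)"
begin

lemma B_add_left: "x \<in> V \<Longrightarrow> y \<in> V \<Longrightarrow> z \<in> V \<Longrightarrow> B (add x y) z = B x z + B y z"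
  by (metis B_herm B_add_right add_closed complex_cnj_add)

lemma B_smul_left: "x \<in> V \<Longrightarrow> y \<in> V \<Longrightarrow> B (smul c x) y = cnj c * B x y"
  by (metis B_herm B_smul_right smul_closed complex_cnj_mult)

lemmas B_simps = B_add_left B_add_right B_smul_left B_smul_right

definition sub :: "'v \<Rightarrow> 'v \<Rightarrow> 'v" where "sub x y = add x (smul (-1) y)"

definition N :: "'v \<Rightarrow> real" where "N x = sqrt (Re (B x x))"

lemma sub_closed [simp, intro]: "x \<in> V \<Longrightarrow> y \<in> V \<Longrightarrow> sub x y \<in> V"
  by (simp add: sub_def)

lemma B_sub_left: "x \<in> V \<Longrightarrow> y \<in> V \<Longrightarrow> z \<in> V \<Longrightarrow> B (sub x y) z = B x z - B y z"
  and B_sub_right: "x \<in> V \<Longrightarrow> y \<in> V \<Longrightarrow> z \<in> V \<Longrightarrow> B z (sub x y) = B z x - B z y"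
  by (simp_all add: sub_def B_simps)

lemma B_self: "x \<in> V \<Longrightarrow> B x x = of_real (Re (B x x))"
proof -
  assume x: "x \<in> V"
  have "Im (B x x) = - Im (B x x)" using arg_cong[OF B_herm[OF x x], of Im] by (simp only: cnj.simps)
  then show ?thesis by (simp add: complex_eq_iff)
qed

lemma N_nonneg [simp]: "x \<in> V \<Longrightarrow> 0 \<le> N x"
  by (simp add: N_def B_nonneg)

lemma N_square: "x \<in> V \<Longrightarrow> (N x)\<^sup>2 = Re (B x x)"
  by (simp add: N_def B_nonneg)

lemma cauchy_schwarz_sq:
  assumes x: "x \<in> V" and y: "y \<in> V"
  shows "(cmod (B x y))\<^sup>2 \<le> Re (B x x) * Re (B y y)"
proof -
  define b where "b = B x y"
  \<comment> \<open>Nonnegativity of the form at \<open>x\<close> minus \<open>t * cnj b\<close>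
    times \<open>y\<close>; the factor \<open>cnj b\<close> turns the phase so that the cross term
    is real. The form may be degenerate, so \<open>t\<close> is kept free instead of being
    normalised by \<open>B y y\<close>.\<close>
  have key: "0 \<le> Re (B x x) - 2 * t * (cmod b)\<^sup>2 + t\<^sup>2 * (cmod b)\<^sup>2 * Re (B y y)" for t :: real
  proof -
    define c where "c = - of_real t * cnj b"
    have yx: "B y x = cnj b" using B_herm[OF y x] by (simp add: b_def)
    have "B (add x (smul c y)) (add x (smul c y))
       = B x x + c * b + cnj c * cnj b + cnj c * c * B y y"
      using x y yx by (simp add: B_simps algebra_simps b_def)
    also have "\<dots> = B x x - of_real (2 * t * (cmod b)\<^sup>2) + of_real (t\<^sup>2 * (cmod b)\<^sup>2) * B y y"
    proof -
      have bb: "of_real ((cmod b)\<^sup>2) = b * cnj b" by (rule complex_norm_square)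
      show ?thesis unfolding c_def of_real_mult bb by (simp add: power2_eq_square algebra_simps)
    qed
    finally have "Re (B (add x (smul c y)) (add x (smul c y)))
       = Re (B x x) - 2 * t * (cmod b)\<^sup>2 + t\<^sup>2 * (cmod b)\<^sup>2 * Re (B y y)"
      by (simp del: of_real_power of_real_mult)
    moreover have "add x (smul c y) \<in> V" using x y by simp
    ultimately show ?thesis using B_nonneg by metis
  qed
  show ?thesis
  proof (cases "Re (B y y) = 0")
    case True
    have "cmod b = 0"
    proof (rule ccontr)
      assume "cmod b \<noteq> 0"
      then have pos: "0 < (cmod b)\<^sup>2" by simp
      \<comment> \<open>With the real part of \<open>B y y\<close> equal to zero the quadratic is
        linear in \<open>t\<close>; this \<open>t\<close> gives the value
        \<open>- Re (B x x) - 2\<close>.\<close>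
      show False
        using key[of "(Re (B x x) + 1) / (cmod b)\<^sup>2"] pos True B_nonneg[OF x]
        by simp
    qed
    then show ?thesis using True by (simp add: b_def)
  next
    case False
    then have pos: "0 < Re (B y y)" using B_nonneg[OF y] by simp
    show ?thesis using key[of "1 / Re (B y y)"] pos
      by (simp add: b_def field_simps power2_eq_square)
  qed
qed

lemma cauchy_schwarz: "x \<in> V \<Longrightarrow> y \<in> V \<Longrightarrow> cmod (B x y) \<le> N x * N y"
  using cauchy_schwarz_sq[of x y] unfolding N_def
  by (metis norm_ge_zero real_sqrt_le_mono real_sqrt_mult real_sqrt_unique)

lemma N_add: assumes x: "x \<in> V" and y: "y \<in> V" shows "N (add x y) \<le> N x + N y"
proof (rule power2_le_imp_le)
  have "B y x = cnj (B x y)" using B_herm x y by blast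
  then have "(N (add x y))\<^sup>2 = (N x)\<^sup>2 + (N y)\<^sup>2 + 2 * Re (B x y)"
    using x y by (simp add: N_square B_simps)
  also have "Re (B x y) \<le> N x * N y"
    using cauchy_schwarz[OF x y] complex_Re_le_cmod[of "B x y"] by linarith
  finally show "(N (add x y))\<^sup>2 \<le> (N x + N y)\<^sup>2"
    by (simp add: power2_sum)
qed (use x y in simp)

lemma N_sub_triangle:
  assumes "x \<in> V" "y \<in> V" "z \<in> V" shows "N (sub x z) \<le> N (sub x y) + N (sub y z)"
proof -
  have "B (sub x z) (sub x z) = B (add (sub x y) (sub y z)) (add (sub x y) (sub y z))"
    using assms by (simp add: B_sub_left B_sub_right B_simps)
  then have "N (sub x z) = N (add (sub x y) (sub y z))" by (simp add: N_def)
  then show ?thesis using N_add assms by simp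
qed

lemma N_sub_commute: "x \<in> V \<Longrightarrow> y \<in> V \<Longrightarrow> N (sub x y) = N (sub y x)"
  by (simp add: N_def B_sub_left B_sub_right)

lemma N_sub_self [simp]: "x \<in> V \<Longrightarrow> N (sub x x) = 0"
  by (simp add: N_def B_sub_left B_sub_right)

lemma N_smul: "x \<in> V \<Longrightarrow> N (smul c x) = cmod c * N x"
proof -
  assume x: "x \<in> V"
  have "B (smul c x) (smul c x) = of_real ((cmod c)\<^sup>2) * B x x"
    using x by (simp add: B_simps complex_norm_square algebra_simps del: of_real_power)
  then have "Re (B (smul c x) (smul c x)) = (cmod c)\<^sup>2 * Re (B x x)"
    by (simp del: of_real_power)
  then show ?thesis by (simp add: N_def real_sqrt_mult)
qed

lemma N_diff_le: assumes "x \<in> V" "y \<in> V" shows "N x \<le> N y + N (sub x y)"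
proof -
  have "N x = N (add y (sub x y))"
    using assms by (simp add: N_def B_sub_left B_sub_right B_simps)
  then show ?thesis using N_add assms by simp
qed

text \<open>Supplies the sum of a list as far as \<open>B\<close> can see it. \<open>V\<close> has
  no distinguished zero, so the empty sum is \<open>smul 0 v\<close> for an arbitrary
  \<open>v\<close>.\<close>

lemma finite_combination:
  assumes "set vs \<subseteq> V"
  obtains G where "G \<in> V" "\<And>w. w \<in> V \<Longrightarrow> B w G = (\<Sum>v\<leftarrow>vs. B w v)"
  using assms
proof (induction vs arbitrary: thesis)
  case Nil
  obtain v where "v \<in> V" using V_nonempty by blast
  then show ?case using Nil(1)[of "smul 0 v"] by (simp add: B_simps)
next
  case (Cons v vs)
  then obtain G where "G \<in> V" "\<And>w. w \<in> V \<Longrightarrow> B w G = (\<Sum>v\<leftarrow>vs. B w v)" by auto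
  then show ?case using Cons(2)[of "add v G"] Cons(3) by (simp add: B_simps)
qed

text \<open>The double sum is \<open>B G G\<close> for the combination \<open>G\<close> of the list.
  This passes from nonnegativity on single vectors to positivity of Gram sums.\<close>

lemma double_sum_nonneg:
  assumes "set vs \<subseteq> V" shows "0 \<le> Re (\<Sum>v\<leftarrow>vs. \<Sum>w\<leftarrow>vs. B v w)"
proof -
  obtain G where G: "G \<in> V" "\<And>w. w \<in> V \<Longrightarrow> B w G = (\<Sum>v\<leftarrow>vs. B w v)"
    using finite_combination[OF assms] by blast
  have "B G G = cnj (\<Sum>v\<leftarrow>vs. B G v)" using B_herm[OF G(1) G(1)] G by simp
  also have "\<dots> = (\<Sum>v\<leftarrow>vs. B v G)"
    using assms
  proof (induction vs)
    case (Cons v vs)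
    then show ?case using B_herm[OF _ G(1), of v] by simp
  qed simp
  also have "\<dots> = (\<Sum>v\<leftarrow>vs. \<Sum>w\<leftarrow>vs. B v w)"
    using G(2) assms by (intro arg_cong[where f=sum_list] map_cong) auto
  finally show ?thesis using B_nonneg[OF G(1)] by simp
qed

section \<open>Cauchy sequences and the completion by limit functionals\<close>

definition cau :: "(nat \<Rightarrow> 'v) \<Rightarrow> bool" where
  "cau s \<longleftrightarrow> (\<forall>n. s n \<in> V) \<and> (\<forall>e>0. \<exists>M. \<forall>m\<ge>M. \<forall>n\<ge>M. N (sub (s m) (s n)) < e)"

text \<open>A point of the completion is the functional \<open>z \<mapsto> lim (B z (s n))\<close> of a Cauchy sequence \<open>s\<close>, so that
  the vector space axioms hold pointwise and no quotient is needed.\<close>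

definition rep :: "(nat \<Rightarrow> 'v) \<Rightarrow> ('v \<Rightarrow> complex) \<Rightarrow> bool" where
  "rep s f \<longleftrightarrow> cau s \<and> (\<forall>z\<in>V. (\<lambda>n. B z (s n)) \<longlonglongrightarrow> f z) \<and> (\<forall>z. z \<notin> V \<longrightarrow> f z = 0)"

definition rp :: "('v \<Rightarrow> complex) \<Rightarrow> nat \<Rightarrow> 'v" where
  "rp f = (SOME s. rep s f)"

text \<open>The limit is taken along the chosen representatives; \<open>cip_lim\<close> makes it
  independent of the choice, and the laws of the inner product are derived from that lemma.\<close>

definition cip :: "('v \<Rightarrow> complex) \<Rightarrow> ('v \<Rightarrow> complex) \<Rightarrow> complex" where
  "cip f g = lim (\<lambda>n. B (rp f n) (rp g n))"

definition cpl :: "('v \<Rightarrow> complex) chs" where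
  "cpl = \<lparr>hs_carrier = {f. \<exists>s. rep s f}, hs_add = (\<lambda>f g z. f z + g z), hs_zero = (\<lambda>_. 0),
          hs_scale = (\<lambda>c f z. c * f z), hs_inner = cip\<rparr>"

definition emb :: "'v \<Rightarrow> 'v \<Rightarrow> complex" where
  "emb v = (\<lambda>z. if z \<in> V then B z v else 0)"

lemma cau_in: "cau s \<Longrightarrow> s n \<in> V" by (simp add: cau_def)

lemma rep_cau: "rep s f \<Longrightarrow> cau s" by (simp add: rep_def)

lemma rep_in: "rep s f \<Longrightarrow> s n \<in> V" by (simp add: rep_def cau_def)

lemma rep_lim: "rep s f \<Longrightarrow> z \<in> V \<Longrightarrow> (\<lambda>n. B z (s n)) \<longlonglongrightarrow> f z" by (simp add: rep_def)

lemma rep_off: "rep s f \<Longrightarrow> z \<notin> V \<Longrightarrow> f z = 0" by (simp add: rep_def)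

lemma rep_rp: "rep s f \<Longrightarrow> rep (rp f) f"
  unfolding rp_def by (rule someI[of "\<lambda>s. rep s f"])

lemma cau_bounded: assumes "cau s" obtains C where "0 < C" "\<And>n. N (s n) \<le> C"
proof -
  obtain M where M: "\<And>m n. m \<ge> M \<Longrightarrow> n \<ge> M \<Longrightarrow> N (sub (s m) (s n)) < 1"
    using assms unfolding cau_def by (metis zero_less_one)
  define C where "C = Max ((\<lambda>n. N (s n)) ` {..M}) + 1"
  have le: "N (s n) \<le> C - 1" if "n \<le> M" for n
    unfolding C_def using that by (simp add: Max_ge)
  have "N (s n) \<le> C" for n
  proof (cases "n \<le> M")
    case False
    have "N (s n) \<le> N (s M) + N (sub (s n) (s M))"
      using N_diff_le cau_in[OF assms] by simp
    also have "\<dots> \<le> (C - 1) + 1" using le[of M] M[of n M] False by (intro add_mono) auto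
    finally show ?thesis by simp
  qed (use le[of n] in linarith)
  moreover have "0 < C" using le[of M] N_nonneg[OF cau_in[OF assms, of M]] by linarith
  ultimately show thesis using that by blast
qed

lemma B_diff_bound:
  assumes "x \<in> V" "y \<in> V" "x' \<in> V" "y' \<in> V"
  shows "cmod (B x y - B x' y') \<le> N (sub x x') * N y + N x' * N (sub y y')"
proof -
  have "B x y - B x' y' = B (sub x x') y + B x' (sub y y')"
    using assms by (simp add: B_sub_left B_sub_right)
  also have "cmod \<dots> \<le> cmod (B (sub x x') y) + cmod (B x' (sub y y'))" by (rule norm_triangle_ineq)
  finally show ?thesis
    using cauchy_schwarz[of "sub x x'" y] cauchy_schwarz[of x' "sub y y'"] assms by fastforce
qed

lemma cau_B_convergent:
  assumes s: "cau s" and t: "cau t" shows "convergent (\<lambda>n. B (s n) (t n))"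
proof -
  obtain C where C: "0 < C" "\<And>n. N (s n) \<le> C" using cau_bounded[OF s] by blast
  obtain D where D: "0 < D" "\<And>n. N (t n) \<le> D" using cau_bounded[OF t] by blast
  have "Cauchy (\<lambda>n. B (s n) (t n))"
    unfolding Cauchy_def
  proof (intro allI impI)
    fix e :: real assume e: "0 < e"
    obtain M1 where M1: "\<And>m n. m \<ge> M1 \<Longrightarrow> n \<ge> M1 \<Longrightarrow> N (sub (s m) (s n)) < e / (2 * D)"
      using s e D(1) unfolding cau_def by (metis divide_pos_pos mult_pos_pos zero_less_numeral)
    obtain M2 where M2: "\<And>m n. m \<ge> M2 \<Longrightarrow> n \<ge> M2 \<Longrightarrow> N (sub (t m) (t n)) < e / (2 * C)"
      using t e C(1) unfolding cau_def by (metis divide_pos_pos mult_pos_pos zero_less_numeral)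
    show "\<exists>M. \<forall>m\<ge>M. \<forall>n\<ge>M. dist (B (s m) (t m)) (B (s n) (t n)) < e"
    proof (intro exI allI impI)
      fix m n assume m: "max M1 M2 \<le> m" and n: "max M1 M2 \<le> n"
      have "cmod (B (s m) (t m) - B (s n) (t n))
          \<le> N (sub (s m) (s n)) * N (t m) + N (s n) * N (sub (t m) (t n))"
        using B_diff_bound cau_in s t by blast
      also have "\<dots> \<le> N (sub (s m) (s n)) * D + C * N (sub (t m) (t n))"
        using C D cau_in s t by (intro add_mono mult_mono) auto
      also have "\<dots> < e / (2 * D) * D + C * (e / (2 * C))"
        using M1[of m n] M2[of m n] m n C(1) D(1) by (intro add_strict_mono mult_strict_right_mono mult_strict_left_mono) auto
      also have "\<dots> = e" using C(1) D(1) by (simp add: field_simps)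
      finally show "dist (B (s m) (t m)) (B (s n) (t n)) < e" by (simp add: dist_norm)
    qed
  qed
  then show ?thesis by (simp add: Cauchy_convergent_iff)
qed

text \<open>A Cauchy sequence \<open>u\<close> that tends to zero weakly tends to zero in seminorm:
  split \<open>B (u n) (u n)\<close> at a fixed late index into \<open>B (u M1) (u n)\<close>, small
  by weak convergence, and a remainder that is small by the Cauchy property and boundedness. Hence a
  functional determines its representing sequences up to null sequences.\<close>

lemma rep_unique:
  assumes s: "rep s f" and t: "rep t f" shows "(\<lambda>n. N (sub (s n) (t n))) \<longlonglongrightarrow> 0"
proof -
  define u where "u n = sub (s n) (t n)" for n
  have uV: "u n \<in> V" for n using rep_in[OF s] rep_in[OF t] by (simp add: u_def)
  have cu: "cau u"
    unfolding cau_def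
  proof (intro conjI allI impI uV)
    fix e :: real assume e: "0 < e"
    obtain M1 where M1: "\<And>m n. m \<ge> M1 \<Longrightarrow> n \<ge> M1 \<Longrightarrow> N (sub (s m) (s n)) < e / 2"
      using rep_cau[OF s] e unfolding cau_def by (meson half_gt_zero)
    obtain M2 where M2: "\<And>m n. m \<ge> M2 \<Longrightarrow> n \<ge> M2 \<Longrightarrow> N (sub (t m) (t n)) < e / 2"
      using rep_cau[OF t] e unfolding cau_def by (meson half_gt_zero)
    show "\<exists>M. \<forall>m\<ge>M. \<forall>n\<ge>M. N (sub (u m) (u n)) < e"
    proof (intro exI allI impI)
      fix m n assume m: "max M1 M2 \<le> m" and n: "max M1 M2 \<le> n"
      have "N (sub (u m) (u n)) = N (add (sub (s m) (s n)) (sub (t n) (t m)))"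
        using rep_in[OF s] rep_in[OF t] by (simp add: u_def N_def B_sub_left B_sub_right B_simps)
      also have "\<dots> \<le> N (sub (s m) (s n)) + N (sub (t n) (t m))"
        using N_add rep_in[OF s] rep_in[OF t] by simp
      also have "\<dots> < e" using M1[of m n] M2[of n m] m n by simp
      finally show "N (sub (u m) (u n)) < e" .
    qed
  qed
  have lim0: "(\<lambda>n. B z (u n)) \<longlonglongrightarrow> 0" if "z \<in> V" for z
    using tendsto_diff[OF rep_lim[OF s that] rep_lim[OF t that]] rep_in[OF s] rep_in[OF t] that
    by (simp add: u_def B_sub_right)
  obtain C where C: "0 < C" "\<And>n. N (u n) \<le> C" using cau_bounded[OF cu] by blast
  have "(\<lambda>n. (N (u n))\<^sup>2) \<longlonglongrightarrow> 0"
  proof (rule LIMSEQ_I)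
    fix e :: real assume e: "0 < e"
    obtain M1 where M1: "\<And>m n. m \<ge> M1 \<Longrightarrow> n \<ge> M1 \<Longrightarrow> N (sub (u m) (u n)) < e / (2 * C)"
      using cu e C(1) unfolding cau_def by (metis divide_pos_pos mult_pos_pos zero_less_numeral)
    obtain M2 where M2: "\<And>n. n \<ge> M2 \<Longrightarrow> cmod (B (u M1) (u n)) < e / 2"
      using LIMSEQ_D[OF lim0[OF uV[of M1]], of "e/2"] e by auto
    show "\<exists>no. \<forall>n\<ge>no. norm ((N (u n))\<^sup>2 - 0) < e"
    proof (intro exI allI impI)
      fix n assume n: "max M1 M2 \<le> n"
      have "B (u n) (u n) = B (u M1) (u n) + B (sub (u n) (u M1)) (u n)"
        using uV by (simp add: B_sub_left)
      then have "(N (u n))\<^sup>2 \<le> cmod (B (u M1) (u n) + B (sub (u n) (u M1)) (u n))"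
        using N_square[OF uV] complex_Re_le_cmod by metis
      also have "\<dots> \<le> cmod (B (u M1) (u n)) + N (sub (u n) (u M1)) * N (u n)"
        using norm_triangle_ineq cauchy_schwarz[of "sub (u n) (u M1)" "u n"] uV
        by (smt (verit) sub_closed)
      also have "\<dots> < e / 2 + e / (2 * C) * C"
      proof (rule add_less_le_mono)
        show "N (sub (u n) (u M1)) * N (u n) \<le> e / (2 * C) * C"
          using M1[of n M1] n C uV e by (intro mult_mono) (auto simp: less_imp_le)
      qed (use M2[of n] n in simp)
      also have "\<dots> = e" using C(1) by simp
      finally show "norm ((N (u n))\<^sup>2 - 0) < e" by simp
    qed
  qed
  then have "(\<lambda>n. sqrt ((N (u n))\<^sup>2)) \<longlonglongrightarrow> sqrt 0" by (rule tendsto_real_sqrt)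
  then show ?thesis using uV by (simp add: u_def)
qed

lemma cip_lim:
  assumes s: "rep s f" and t: "rep t g" shows "(\<lambda>n. B (s n) (t n)) \<longlonglongrightarrow> cip f g"
proof -
  let ?s = "rp f" and ?t = "rp g"
  note s' = rep_rp[OF s] and t' = rep_rp[OF t]
  obtain C where C: "0 < C" "\<And>n. N (?s n) \<le> C" using cau_bounded[OF rep_cau[OF s']] by blast
  obtain D where D: "0 < D" "\<And>n. N (t n) \<le> D" using cau_bounded[OF rep_cau[OF t]] by blast
  have 1: "(\<lambda>n. B (?s n) (?t n)) \<longlonglongrightarrow> cip f g"
    unfolding cip_def using cau_B_convergent[OF rep_cau[OF s'] rep_cau[OF t']]
    by (simp add: convergent_LIMSEQ_iff)
  have 2: "(\<lambda>n. N (sub (s n) (?s n)) * D + C * N (sub (t n) (?t n))) \<longlonglongrightarrow> 0 * D + C * 0"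
    by (intro tendsto_intros rep_unique[OF s s'] rep_unique[OF t t'])
  have "(\<lambda>n. B (s n) (t n) - B (?s n) (?t n)) \<longlonglongrightarrow> 0"
  proof (rule Lim_null_comparison)
    show "\<forall>\<^sub>F n in sequentially. cmod (B (s n) (t n) - B (?s n) (?t n))
        \<le> N (sub (s n) (?s n)) * D + C * N (sub (t n) (?t n))"
    proof (intro always_eventually allI)
      fix n
      note V = rep_in[OF s, of n] rep_in[OF s', of n] rep_in[OF t, of n] rep_in[OF t', of n]
      have "cmod (B (s n) (t n) - B (?s n) (?t n))
        \<le> N (sub (s n) (?s n)) * N (t n) + N (?s n) * N (sub (t n) (?t n))"
        using B_diff_bound V by blast
      also have "\<dots> \<le> N (sub (s n) (?s n)) * D + C * N (sub (t n) (?t n))"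
        using C D V by (intro add_mono mult_mono) auto
      finally show "cmod (B (s n) (t n) - B (?s n) (?t n))
        \<le> N (sub (s n) (?s n)) * D + C * N (sub (t n) (?t n))" .
    qed
  qed (use 2 in simp)
  from tendsto_add[OF this 1] show ?thesis by simp
qed

text \<open>One criterion for all derived sequences: sums use \<open>c = 1\<close>, multiples use
  the modulus of the scalar, isometric images use \<open>c = 0\<close>.\<close>

lemma cau_comp:
  assumes s: "cau s" and t: "cau t" and u: "\<And>n. u n \<in> V"
    and le: "\<And>m n. N (sub (u m) (u n)) \<le> c * N (sub (s m) (s n)) + N (sub (t m) (t n))" and c: "0 \<le> c"
  shows "cau u"
  unfolding cau_def
proof (intro conjI allI impI u)
  fix e :: real assume e: "0 < e"
  \<comment> \<open>\<open>c + 1\<close> rather than \<open>c\<close> in the denominator, since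
    \<open>c = 0\<close> occurs.\<close>
  have e': "0 < e / (2 * (c + 1))" using e c by simp
  obtain M1 where M1: "\<And>m n. m \<ge> M1 \<Longrightarrow> n \<ge> M1 \<Longrightarrow> N (sub (s m) (s n)) < e / (2 * (c + 1))"
    using s e' unfolding cau_def by blast
  obtain M2 where M2: "\<And>m n. m \<ge> M2 \<Longrightarrow> n \<ge> M2 \<Longrightarrow> N (sub (t m) (t n)) < e / 2"
    using t e unfolding cau_def by (meson half_gt_zero)
  show "\<exists>M. \<forall>m\<ge>M. \<forall>n\<ge>M. N (sub (u m) (u n)) < e"
  proof (intro exI allI impI)
    fix m n assume m: "max M1 M2 \<le> m" and n: "max M1 M2 \<le> n"
    have "c * N (sub (s m) (s n)) \<le> c * (e / (2 * (c + 1)))"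
      using M1[of m n] m n c by (intro mult_left_mono) auto
    also have "\<dots> \<le> e / 2" using c e by (simp add: field_simps)
    finally show "N (sub (u m) (u n)) < e" using le[of m n] M2[of m n] m n by auto
  qed
qed

lemma rep_add:
  assumes s: "rep s f" and t: "rep t g" shows "rep (\<lambda>n. add (s n) (t n)) (\<lambda>z. f z + g z)"
  unfolding rep_def
proof (intro conjI ballI allI impI)
  note V = rep_in[OF s] rep_in[OF t]
  show "cau (\<lambda>n. add (s n) (t n))"
  proof (rule cau_comp[OF rep_cau[OF s] rep_cau[OF t], where c=1])
    fix m n
    have "N (sub (add (s m) (t m)) (add (s n) (t n))) = N (add (sub (s m) (s n)) (sub (t m) (t n)))"
      using V by (simp add: N_def B_sub_left B_sub_right B_simps)
    also have "\<dots> \<le> N (sub (s m) (s n)) + N (sub (t m) (t n))" using V N_add by simp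
    finally show "N (sub (add (s m) (t m)) (add (s n) (t n)))
      \<le> 1 * N (sub (s m) (s n)) + N (sub (t m) (t n))" by simp
  qed (use V in auto)
  show "(\<lambda>n. B z (add (s n) (t n))) \<longlonglongrightarrow> f z + g z" if "z \<in> V" for z
    using tendsto_add[OF rep_lim[OF s that] rep_lim[OF t that]] V that by (simp add: B_simps)
  show "f z + g z = 0" if "z \<notin> V" for z using s t that by (simp add: rep_def)
qed

lemma rep_smul:
  assumes s: "rep s f" shows "rep (\<lambda>n. smul c (s n)) (\<lambda>z. c * f z)"
  unfolding rep_def
proof (intro conjI ballI allI impI)
  note V = rep_in[OF s]
  show "cau (\<lambda>n. smul c (s n))"
  proof (rule cau_comp[OF rep_cau[OF s] rep_cau[OF s], where c="cmod c"])
    fix m n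
    have "N (sub (smul c (s m)) (smul c (s n))) = N (smul c (sub (s m) (s n)))"
      using V by (simp add: N_def B_sub_left B_sub_right B_simps algebra_simps)
    then show "N (sub (smul c (s m)) (smul c (s n)))
      \<le> cmod c * N (sub (s m) (s n)) + N (sub (s m) (s n))" using V by (simp add: N_smul)
  qed (use V in auto)
  show "(\<lambda>n. B z (smul c (s n))) \<longlonglongrightarrow> c * f z" if "z \<in> V" for z
    using tendsto_mult_left[OF rep_lim[OF s that], of c] V that by (simp add: B_simps)
  show "c * f z = 0" if "z \<notin> V" for z using s that by (simp add: rep_def)
qed

lemma rep_emb: "v \<in> V \<Longrightarrow> rep (\<lambda>_. v) (emb v)"
  by (auto simp: rep_def cau_def emb_def)

lemma rep_zero: "\<exists>s. rep s (\<lambda>_. 0)"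
proof -
  obtain v where "v \<in> V" using V_nonempty by blast
  from rep_smul[OF rep_emb[OF this], of 0] show ?thesis by auto
qed

text \<open>Points of the completion are antilinear functionals because \<open>B\<close> is
  antilinear on the left. This is how scalars are moved through maps that act by
  precomposition.\<close>

lemma rep_val_smul:
  assumes s: "rep s f" and z: "z \<in> V" shows "f (smul c z) = cnj c * f z"
proof (rule LIMSEQ_unique[OF rep_lim[OF s]])
  show "(\<lambda>n. B (smul c z) (s n)) \<longlonglongrightarrow> cnj c * f z"
    using tendsto_mult_left[OF rep_lim[OF s z], of "cnj c"] rep_in[OF s] z by (simp add: B_simps)
qed (use z in simp)

text \<open>Takes the place of a quotient by null vectors: a point of the completion cannot
  distinguish arguments that \<open>B\<close> identifies.\<close>

lemma rep_val_cong:
  assumes s: "rep s f" and z: "z \<in> V" "z' \<in> V" and eq: "\<And>w. w \<in> V \<Longrightarrow> B z w = B z' w"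
  shows "f z = f z'"
  using LIMSEQ_unique[OF rep_lim[OF s z(1)], unfolded eq[OF rep_in[OF s]], OF rep_lim[OF s z(2)]] .

lemma cip_emb: "rep s f \<Longrightarrow> v \<in> V \<Longrightarrow> cip (emb v) f = f v"
  by (rule LIMSEQ_unique[OF cip_lim[OF rep_emb] rep_lim])

lemma cip_herm: assumes "rep s f" "rep t g" shows "cip f g = cnj (cip g f)"
proof (rule LIMSEQ_unique[OF cip_lim[OF assms]])
  have "(\<lambda>n. cnj (B (t n) (s n))) \<longlonglongrightarrow> cnj (cip g f)"
    by (intro tendsto_cnj cip_lim assms)
  moreover have "cnj (B (t n) (s n)) = B (s n) (t n)" for n
    using B_herm[of "s n" "t n"] rep_in assms by metis
  ultimately show "(\<lambda>n. B (s n) (t n)) \<longlonglongrightarrow> cnj (cip g f)" by simp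
qed

lemma cip_add: assumes s: "rep s f" and t: "rep t g" and u: "rep u h"
  shows "cip f (\<lambda>z. g z + h z) = cip f g + cip f h"
proof (rule LIMSEQ_unique[OF cip_lim[OF s rep_add[OF t u]]])
  show "(\<lambda>n. B (s n) (add (t n) (u n))) \<longlonglongrightarrow> cip f g + cip f h"
    using tendsto_add[OF cip_lim[OF s t] cip_lim[OF s u]] rep_in[OF s] rep_in[OF t] rep_in[OF u]
    by (simp add: B_simps)
qed

lemma cip_smul: assumes s: "rep s f" and t: "rep t g"
  shows "cip f (\<lambda>z. c * g z) = c * cip f g"
proof (rule LIMSEQ_unique[OF cip_lim[OF s rep_smul[OF t]]])
  show "(\<lambda>n. B (s n) (smul c (t n))) \<longlonglongrightarrow> c * cip f g"
    using tendsto_mult_left[OF cip_lim[OF s t], of c] rep_in[OF s] rep_in[OF t] by (simp add: B_simps)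
qed

lemma cip_nonneg: assumes s: "rep s f" shows "0 \<le> Re (cip f f)"
  by (rule LIMSEQ_le_const[OF tendsto_Re[OF cip_lim[OF s s]]]) (simp add: B_nonneg[OF rep_in[OF s]])

lemma cip_definite: assumes s: "rep s f" and 0: "cip f f = 0" shows "f = (\<lambda>_. 0)"
proof
  fix z
  show "f z = 0"
  proof (cases "z \<in> V")
    case True
    have "(\<lambda>n. N (s n)) \<longlonglongrightarrow> 0"
      using tendsto_real_sqrt[OF tendsto_Re[OF cip_lim[OF s s]]] 0 by (simp add: N_def)
    then have l: "(\<lambda>n. N z * N (s n)) \<longlonglongrightarrow> 0" by (rule tendsto_mult_right_zero)
    have "(\<lambda>n. B z (s n)) \<longlonglongrightarrow> 0"
      by (rule Lim_null_comparison[OF _ l]) (simp add: cauchy_schwarz rep_in[OF s] True)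
    then show ?thesis using rep_lim[OF s True] LIMSEQ_unique by blast
  qed (use s in \<open>simp add: rep_def\<close>)
qed

end

text \<open>The axioms are stated in bounded-quantifier form to match \<open>chs_hilbert_def\<close> literally.\<close>

locale inner_space =
  fixes S :: "'a chs"
  assumes zero_closed [simp, intro]: "hs_zero S \<in> hs_carrier S"
    and add_closed_ball: "\<forall>x\<in>hs_carrier S. \<forall>y\<in>hs_carrier S. hs_add S x y \<in> hs_carrier S"
    and scale_closed_ball: "\<forall>a. \<forall>x\<in>hs_carrier S. hs_scale S a x \<in> hs_carrier S"
    and add_assoc_ball: "\<forall>x\<in>hs_carrier S. \<forall>y\<in>hs_carrier S. \<forall>z\<in>hs_carrier S.
        hs_add S (hs_add S x y) z = hs_add S x (hs_add S y z)"
    and add_commute_ball: "\<forall>x\<in>hs_carrier S. \<forall>y\<in>hs_carrier S. hs_add S x y = hs_add S y x"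
    and add_zero_ball: "\<forall>x\<in>hs_carrier S. hs_add S x (hs_zero S) = x"
    and add_neg_ball: "\<forall>x\<in>hs_carrier S. hs_add S x (hs_scale S (-1) x) = hs_zero S"
    and scale_scale_ball: "\<forall>a b. \<forall>x\<in>hs_carrier S. hs_scale S a (hs_scale S b x) = hs_scale S (a * b) x"
    and scale_one_ball: "\<forall>x\<in>hs_carrier S. hs_scale S 1 x = x"
    and scale_add_ball: "\<forall>a. \<forall>x\<in>hs_carrier S. \<forall>y\<in>hs_carrier S.
        hs_scale S a (hs_add S x y) = hs_add S (hs_scale S a x) (hs_scale S a y)"
    and add_scale_ball: "\<forall>a b. \<forall>x\<in>hs_carrier S.
        hs_scale S (a + b) x = hs_add S (hs_scale S a x) (hs_scale S b x)"
    and inner_herm_ball: "\<forall>x\<in>hs_carrier S. \<forall>y\<in>hs_carrier S. hs_inner S x y = cnj (hs_inner S y x)"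
    and inner_add_ball: "\<forall>x\<in>hs_carrier S. \<forall>y\<in>hs_carrier S. \<forall>z\<in>hs_carrier S.
        hs_inner S x (hs_add S y z) = hs_inner S x y + hs_inner S x z"
    and inner_scale_ball: "\<forall>a. \<forall>x\<in>hs_carrier S. \<forall>y\<in>hs_carrier S.
        hs_inner S x (hs_scale S a y) = a * hs_inner S x y"
    and inner_nonneg_ball: "\<forall>x\<in>hs_carrier S. Re (hs_inner S x x) \<ge> 0"
    and inner_definite_ball: "\<forall>x\<in>hs_carrier S. hs_inner S x x = 0 \<longrightarrow> x = hs_zero S"
begin

lemmas hs_add_closed [simp, intro] = add_closed_ball[rule_format]
lemmas hs_scale_closed [simp, intro] = scale_closed_ball[rule_format]
lemmas hs_add_assoc = add_assoc_ball[rule_format]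
lemmas hs_add_commute = add_commute_ball[rule_format]
lemmas hs_add_zero [simp] = add_zero_ball[rule_format]
lemmas hs_add_neg = add_neg_ball[rule_format]
lemmas hs_scale_scale [simp] = scale_scale_ball[rule_format]
lemmas hs_scale_one [simp] = scale_one_ball[rule_format]
lemmas hs_scale_add = scale_add_ball[rule_format]
lemmas hs_add_scale = add_scale_ball[rule_format]
lemmas hs_inner_herm = inner_herm_ball[rule_format]
lemmas hs_inner_add = inner_add_ball[rule_format]
lemmas hs_inner_scale = inner_scale_ball[rule_format]
lemmas hs_inner_nonneg = inner_nonneg_ball[rule_format]
lemmas hs_inner_definite = inner_definite_ball[rule_format]

sublocale semi_ip "hs_carrier S" "hs_add S" "hs_scale S" "hs_inner S"
  by unfold_locales (auto simp: hs_inner_add hs_inner_scale hs_inner_nonneg hs_inner_herm[symmetric])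

lemma N_eq: "N = hs_norm S" by (simp add: N_def hs_norm_def fun_eq_iff)

lemma sub_eq: "sub = hs_minus S" by (simp add: sub_def hs_minus_def fun_eq_iff)

end

definition chs_complete :: "'a chs \<Rightarrow> bool" where
  "chs_complete S \<longleftrightarrow> (\<forall>s :: nat \<Rightarrow> 'a. (\<forall>n. s n \<in> hs_carrier S) \<and>
          (\<forall>e>0. \<exists>N. \<forall>m\<ge>N. \<forall>n\<ge>N. hs_norm S (hs_minus S (s m) (s n)) < e) \<longrightarrow>
          (\<exists>x\<in>hs_carrier S. \<forall>e>0. \<exists>N. \<forall>n\<ge>N. hs_norm S (hs_minus S (s n) x) < e))"

lemma chs_hilbert_iff: "chs_hilbert S \<longleftrightarrow> inner_space S \<and> chs_complete S"
  unfolding chs_hilbert_def inner_space_def chs_complete_def conj_assoc by (rule refl)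

section \<open>Completeness of the completion and extension of maps to it\<close>

context semi_ip
begin

lemma inner_space_cpl: "inner_space cpl"
proof (unfold_locales; (intro ballI allI impI)?)
  fix f g :: "'v \<Rightarrow> complex" and h a b
  assume "f \<in> hs_carrier cpl"
  then obtain s where s: "rep s f" by (auto simp: cpl_def)
  show "hs_scale cpl a f \<in> hs_carrier cpl" using rep_smul[OF s] by (auto simp: cpl_def)
  show "0 \<le> Re (hs_inner cpl f f)" using cip_nonneg[OF s] by (simp add: cpl_def)
  show "hs_inner cpl f f = 0 \<Longrightarrow> f = hs_zero cpl" using cip_definite[OF s] by (simp add: cpl_def)
  assume "g \<in> hs_carrier cpl"
  then obtain t where t: "rep t g" by (auto simp: cpl_def)
  show "hs_add cpl f g \<in> hs_carrier cpl" using rep_add[OF s t] by (auto simp: cpl_def)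
  show "hs_inner cpl f g = cnj (hs_inner cpl g f)" using cip_herm[OF s t] by (simp add: cpl_def)
  show "hs_inner cpl f (hs_scale cpl a g) = a * hs_inner cpl f g"
    using cip_smul[OF s t] by (simp add: cpl_def)
  assume "h \<in> hs_carrier cpl"
  then obtain u where u: "rep u h" by (auto simp: cpl_def)
  show "hs_inner cpl f (hs_add cpl g h) = hs_inner cpl f g + hs_inner cpl f h"
    using cip_add[OF s t u] by (simp add: cpl_def)
qed (use rep_zero in \<open>auto simp: cpl_def algebra_simps\<close>)

lemma emb_in_cpl: "v \<in> V \<Longrightarrow> emb v \<in> hs_carrier cpl"
  using rep_emb by (auto simp: cpl_def)

lemma cpl_norm_sub_emb:
  assumes s: "rep s f" and v: "v \<in> V"
  shows "(\<lambda>n. N (sub (s n) v)) \<longlonglongrightarrow> hs_norm cpl (hs_minus cpl f (emb v))"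
proof -
  have "rep (\<lambda>n. sub (s n) v) (hs_minus cpl f (emb v))"
    using rep_add[OF s rep_smul[OF rep_emb[OF v], of "-1"]]
    by (simp add: sub_def hs_minus_def cpl_def)
  from tendsto_real_sqrt[OF tendsto_Re[OF cip_lim[OF this this]]]
  show ?thesis by (simp add: N_def hs_norm_def cpl_def)
qed

text \<open>Density of the embedded space: each point is approached by its own representing
  sequence.\<close>

lemma rep_tendsto:
  assumes s: "rep s f" and e: "0 < e"
  shows "\<exists>M. \<forall>n\<ge>M. hs_norm cpl (hs_minus cpl f (emb (s n))) < e"
proof -
  obtain M where M: "\<And>m n. m \<ge> M \<Longrightarrow> n \<ge> M \<Longrightarrow> N (sub (s m) (s n)) < e / 2"
    using rep_cau[OF s] e unfolding cau_def by (meson half_gt_zero)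
  have "hs_norm cpl (hs_minus cpl f (emb (s n))) \<le> e / 2" if "n \<ge> M" for n
    using cpl_norm_sub_emb[OF s rep_in[OF s]]
    by (rule LIMSEQ_le_const2) (use M that in \<open>auto intro!: exI[of _ M] less_imp_le\<close>)
  then show ?thesis using e by (intro exI[of _ M]) force
qed

text \<open>Diagonal argument: each \<open>F n\<close> is replaced by an embedded \<open>v n\<close>
  at distance less than \<open>1 / real (Suc n)\<close>. The sequence \<open>v\<close> is Cauchy in
  \<open>V\<close>, so it represents a point, and that point is the limit of
  \<open>F\<close>.\<close>

lemma chs_hilbert_cpl: "chs_hilbert cpl"
proof -
  interpret c: inner_space cpl by (rule inner_space_cpl)
  have "chs_complete cpl"
    unfolding chs_complete_def
  proof (intro allI impI, elim conjE)
    fix F :: "nat \<Rightarrow> 'v \<Rightarrow> complex"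
    assume F: "\<forall>n. F n \<in> hs_carrier cpl"
      and cauF: "\<forall>e>0. \<exists>M. \<forall>m\<ge>M. \<forall>n\<ge>M. hs_norm cpl (hs_minus cpl (F m) (F n)) < e"
    have "\<exists>v\<in>V. c.N (c.sub (F n) (emb v)) < 1 / real (Suc n)" for n
    proof -
      obtain s where s: "rep s (F n)" using F by (auto simp: cpl_def)
      from rep_tendsto[OF s, of "1 / real (Suc n)"] show ?thesis
        using rep_in[OF s] by (auto simp: c.N_eq c.sub_eq)
    qed
    then obtain v where vV: "\<And>n. v n \<in> V" and v: "\<And>n. c.N (c.sub (F n) (emb (v n))) < 1 / real (Suc n)"
      by metis
    have Nv: "N (sub (v m) (v n)) = c.N (c.sub (emb (v m)) (emb (v n)))" for m n
      using LIMSEQ_unique[OF cpl_norm_sub_emb[OF rep_emb[OF vV] vV] tendsto_const]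
      by (simp add: c.N_eq c.sub_eq)
    have small: "\<exists>M. \<forall>n\<ge>M. 1 / real (Suc n) < e" if "0 < e" for e :: real
    proof -
      obtain M where "1 / real (Suc M) < e" using \<open>0 < e\<close> nat_approx_posE by blast
      then have "1 / real (Suc n) < e" if "n \<ge> M" for n
        using that by (smt (verit) frac_le of_nat_0_less_iff of_nat_mono Suc_le_mono zero_less_Suc)
      then show ?thesis by blast
    qed
    have "cau v"
      unfolding cau_def
    proof (intro conjI allI impI vV)
      fix e :: real assume e: "0 < e"
      obtain M1 where M1: "\<And>m n. m \<ge> M1 \<Longrightarrow> n \<ge> M1 \<Longrightarrow> c.N (c.sub (F m) (F n)) < e / 3"
        using cauF e unfolding c.N_eq c.sub_eq by (meson divide_pos_pos zero_less_numeral)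
      obtain M2 where M2: "\<And>n. n \<ge> M2 \<Longrightarrow> 1 / real (Suc n) < e / 3"
        using small[of "e / 3"] e by auto
      show "\<exists>M. \<forall>m\<ge>M. \<forall>n\<ge>M. N (sub (v m) (v n)) < e"
      proof (intro exI allI impI)
        fix m n assume m: "max M1 M2 \<le> m" and n: "max M1 M2 \<le> n"
        note E = emb_in_cpl[OF vV] F[rule_format]
        have "c.N (c.sub (emb (v m)) (emb (v n)))
           \<le> c.N (c.sub (emb (v m)) (F m)) + (c.N (c.sub (F m) (F n)) + c.N (c.sub (F n) (emb (v n))))"
          using c.N_sub_triangle[OF E(1)[of m] E(2)[of m] E(1)[of n]] c.N_sub_triangle[OF E(2)[of m] E(2)[of n] E(1)[of n]]
          by linarith
        also have "c.N (c.sub (emb (v m)) (F m)) = c.N (c.sub (F m) (emb (v m)))"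
          by (rule c.N_sub_commute[OF E])
        finally show "N (sub (v m) (v n)) < e"
          using v[of m] v[of n] M1[of m n] M2[of m] M2[of n] m n by (simp add: Nv)
      qed
    qed
    define f where "f z = (if z \<in> V then lim (\<lambda>n. B z (v n)) else 0)" for z
    have "rep v f"
      unfolding rep_def
    proof (intro conjI ballI)
      fix z assume "z \<in> V"
      then have "cau (\<lambda>_. z)" by (auto simp: cau_def)
      from cau_B_convergent[OF this \<open>cau v\<close>] show "(\<lambda>n. B z (v n)) \<longlonglongrightarrow> f z"
        using \<open>z \<in> V\<close> by (simp add: f_def convergent_LIMSEQ_iff)
    qed (use \<open>cau v\<close> in \<open>auto simp: f_def\<close>)
    then have fc: "f \<in> hs_carrier cpl" by (auto simp: cpl_def)
    show "\<exists>x\<in>hs_carrier cpl. \<forall>e>0. \<exists>M. \<forall>n\<ge>M. hs_norm cpl (hs_minus cpl (F n) x) < e"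
    proof (intro bexI[OF _ fc] allI impI)
      fix e :: real assume e: "0 < e"
      obtain M1 where M1: "\<And>n. n \<ge> M1 \<Longrightarrow> c.N (c.sub f (emb (v n))) < e / 2"
        using rep_tendsto[OF \<open>rep v f\<close>, of "e / 2"] e by (auto simp: c.N_eq c.sub_eq)
      obtain M2 where M2: "\<And>n. n \<ge> M2 \<Longrightarrow> 1 / real (Suc n) < e / 2"
        using small[of "e / 2"] e by auto
      show "\<exists>M. \<forall>n\<ge>M. hs_norm cpl (hs_minus cpl (F n) f) < e"
      proof (intro exI allI impI)
        fix n assume n: "max M1 M2 \<le> n"
        note E = emb_in_cpl[OF vV, of n] F[rule_format, of n]
        have "c.N (c.sub (F n) f) \<le> c.N (c.sub (F n) (emb (v n))) + c.N (c.sub (emb (v n)) f)"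
          by (rule c.N_sub_triangle[OF E(2) E(1) fc])
        also have "c.N (c.sub (emb (v n)) f) = c.N (c.sub f (emb (v n)))"
          by (rule c.N_sub_commute[OF E(1) fc])
        finally show "hs_norm cpl (hs_minus cpl (F n) f) < e"
          using v[of n] M1[of n] M2[of n] n by (simp add: c.N_eq c.sub_eq)
      qed
    qed
  qed
  then show ?thesis using inner_space_cpl by (simp add: chs_hilbert_iff)
qed

text \<open>Precomposition with \<open>u'\<close>, the adjoint of \<open>u\<close> for
  \<open>B\<close>, is the continuous extension of \<open>u\<close> (see \<open>rep_lift\<close>):
  the functional of the sequence \<open>u (s n)\<close> at \<open>z\<close> is the limit of
  \<open>B (u' z) (s n)\<close>. The definition therefore chooses no representatives.\<close>

definition lift :: "('v \<Rightarrow> 'v) \<Rightarrow> ('v \<Rightarrow> complex) \<Rightarrow> 'v \<Rightarrow> complex" where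
  "lift u' f = (\<lambda>z. if z \<in> V then f (u' z) else 0)"

lemma rep_lift:
  assumes u: "\<And>z. z \<in> V \<Longrightarrow> u z \<in> V" and u': "\<And>z. z \<in> V \<Longrightarrow> u' z \<in> V"
    and adj: "\<And>z w. z \<in> V \<Longrightarrow> w \<in> V \<Longrightarrow> B (u' z) w = B z (u w)"
    and iso: "\<And>z w. z \<in> V \<Longrightarrow> w \<in> V \<Longrightarrow> B (u z) (u w) = B z w"
    and s: "rep s f"
  shows "rep (\<lambda>n. u (s n)) (lift u' f)"
  unfolding rep_def
proof (intro conjI ballI allI impI)
  note sV = rep_in[OF s]
  show "cau (\<lambda>n. u (s n))"
    by (rule cau_comp[OF rep_cau[OF s] rep_cau[OF s], where c=0])
       (simp_all add: sV u N_def B_sub_left B_sub_right iso)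
  show "(\<lambda>n. B z (u (s n))) \<longlonglongrightarrow> lift u' f z" if "z \<in> V" for z
    using rep_lim[OF s u'[OF that]] that sV by (simp add: lift_def adj)
qed (simp add: lift_def)

text \<open>Inverse relations are stated under \<open>B\<close>, since the maps on generators undo
  each other only up to null vectors. Surjectivity comes from lifting \<open>u\<close> as well,
  which gives the inverse.\<close>

lemma lift_unitary:
  assumes u: "\<And>z. z \<in> V \<Longrightarrow> u z \<in> V" and u': "\<And>z. z \<in> V \<Longrightarrow> u' z \<in> V"
    and adj: "\<And>z w. z \<in> V \<Longrightarrow> w \<in> V \<Longrightarrow> B (u' z) w = B z (u w)"
    and uu': "\<And>z w. z \<in> V \<Longrightarrow> w \<in> V \<Longrightarrow> B (u (u' z)) w = B z w"
    and u'u: "\<And>z w. z \<in> V \<Longrightarrow> w \<in> V \<Longrightarrow> B (u' (u z)) w = B z w"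
  shows "chs_unitary cpl (lift u')"
proof -
  have adj': "B (u z) w = B z (u' w)" if "z \<in> V" "w \<in> V" for z w
    using adj[OF that(2,1)] B_herm[OF u[OF that(1)] that(2)] B_herm[OF that(1) u'[OF that(2)]] by simp
  have iso: "B (u z) (u w) = B z w" if "z \<in> V" "w \<in> V" for z w
    using adj[OF u[OF that(1)] that(2)] u'u[OF that] by simp
  have iso': "B (u' z) (u' w) = B z w" if "z \<in> V" "w \<in> V" for z w
    using adj'[OF u'[OF that(1)] that(2)] uu'[OF that] by simp
  have R: "rep (\<lambda>n. u (s n)) (lift u' f)" if "rep s f" for s f
    by (rule rep_lift[of u u' s f, OF u u' adj iso that])
  have R': "rep (\<lambda>n. u' (s n)) (lift u f)" if "rep s f" for s f
    by (rule rep_lift[of u' u s f, OF u' u adj' iso' that])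
  have closed: "lift u' f \<in> hs_carrier cpl" if f: "f \<in> hs_carrier cpl" for f
  proof -
    obtain s where s: "rep s f" using f by (auto simp: cpl_def)
    show ?thesis using R[OF s] by (auto simp: cpl_def)
  qed
  have "hs_norm cpl (lift u' f) = hs_norm cpl f" if f: "f \<in> hs_carrier cpl" for f
  proof -
    obtain s where s: "rep s f" using f by (auto simp: cpl_def)
    have "(\<lambda>n. B (s n) (s n)) \<longlonglongrightarrow> cip (lift u' f) (lift u' f)"
      using cip_lim[OF R[OF s] R[OF s]] by (simp add: iso rep_in[OF s])
    then have "cip (lift u' f) (lift u' f) = cip f f"
      using cip_lim[OF s s] by (rule LIMSEQ_unique)
    then show ?thesis by (simp add: hs_norm_def cpl_def)
  qed
  moreover have "hs_linear cpl cpl (lift u')"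
    unfolding hs_linear_def by (intro conjI ballI allI closed) (simp_all add: cpl_def lift_def fun_eq_iff)
  moreover have "f \<in> lift u' ` hs_carrier cpl" if f: "f \<in> hs_carrier cpl" for f
  proof
    obtain s where s: "rep s f" using f by (auto simp: cpl_def)
    show "lift u f \<in> hs_carrier cpl" using R'[OF s] by (auto simp: cpl_def)
    have "f (u (u' z)) = f z" if "z \<in> V" for z
      using rep_val_cong[OF s u[OF u'[OF that]] that] uu'[OF that] by simp
    then show "f = lift u' (lift u f)"
      using u' rep_off[OF s] by (simp add: lift_def fun_eq_iff)
  qed
  ultimately show ?thesis
    unfolding chs_unitary_def chs_isometry_def using closed by blast
qed

lemma lift_emb:
  assumes "v \<in> V" and u': "\<And>z. z \<in> V \<Longrightarrow> u' z \<in> V"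
    and adj: "\<And>z. z \<in> V \<Longrightarrow> B (u' z) v = B z (u v)"
  shows "lift u' (emb v) = emb (u v)"
  by (rule ext) (simp add: lift_def emb_def u' adj)

end

section \<open>Weyl-normalised products and defect forms\<close>

text \<open>The biadditive extension of \<open>\<sigma>\<close> to multisets; \<open>cis\<close> of
  it is the cocycle in the Weyl relation \<open>Tm_Tm\<close>.\<close>

definition mform :: "('i \<Rightarrow> 'i \<Rightarrow> real) \<Rightarrow> 'i multiset \<Rightarrow> 'i multiset \<Rightarrow> real" where
  "mform \<sigma> m n = (\<Sum>a\<in>#m. \<Sum>b\<in>#n. \<sigma> a b)"

lemma mform_empty [simp]: "mform \<sigma> {#} n = 0" "mform \<sigma> m {#} = 0"
  by (simp_all add: mform_def)

lemma mform_add_mset_left: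
  "mform \<sigma> (add_mset a m) n = mform \<sigma> {#a#} n + mform \<sigma> m n"
  by (simp_all add: mform_def)

lemma mform_single: "mform \<sigma> {#a#} {#b#} = \<sigma> a b"
  by (simp add: mform_def)

lemma mform_add_left: "mform \<sigma> (m + m') n = mform \<sigma> m n + mform \<sigma> m' n"
  by (simp add: mform_def)

lemma mform_add_right: "mform \<sigma> m (n + n') = mform \<sigma> m n + mform \<sigma> m n'"
  by (simp add: mform_def sum_mset.distrib)

lemma mform_add_mset_right: "mform \<sigma> m (add_mset a n) = mform \<sigma> m {#a#} + mform \<sigma> m n"
  by (simp add: mform_def sum_mset.distrib)

lemma mform_antisym:
  assumes "\<And>a b. \<sigma> a b = - \<sigma> b a" shows "mform \<sigma> m n = - mform \<sigma> n m"
proof (induction m)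
  case (add a m)
  have "mform \<sigma> {#a#} n = - mform \<sigma> n {#a#}"
  proof (induction n)
    case (add b n)
    then show ?case
      using mform_add_mset_left[of \<sigma> b n "{#a#}"] mform_add_mset_right[of \<sigma> "{#a#}" b n] assms[of a b]
      by (simp add: mform_single)
  qed simp
  then show ?case using add mform_add_mset_left[of \<sigma> a m n] mform_add_mset_right[of \<sigma> n a m] by simp
qed simp

locale twisted_family = inner_space H
  for H :: "'h chs" +
  fixes T :: "'i \<Rightarrow> 'h \<Rightarrow> 'h" and \<sigma> :: "'i \<Rightarrow> 'i \<Rightarrow> real"
  assumes T_closed [simp, intro]: "x \<in> hs_carrier H \<Longrightarrow> T a x \<in> hs_carrier H"
    and T_add: "x \<in> hs_carrier H \<Longrightarrow> y \<in> hs_carrier H \<Longrightarrow> T a (hs_add H x y) = hs_add H (T a x) (T a y)"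
    and T_scale: "x \<in> hs_carrier H \<Longrightarrow> T a (hs_scale H c x) = hs_scale H c (T a x)"
    and T_comm: "x \<in> hs_carrier H \<Longrightarrow> T a (T b x) = hs_scale H (cis (2 * \<sigma> a b)) (T b (T a x))"
    and \<sigma>_antisym: "\<sigma> a b = - \<sigma> b a"
begin

abbreviation "C \<equiv> hs_carrier H"
abbreviation "ip \<equiv> hs_inner H"
abbreviation "sc \<equiv> hs_scale H"
abbreviation "s \<equiv> mform \<sigma>"

lemma s_antisym: "s m n = - s n m"
  by (rule mform_antisym) (rule \<sigma>_antisym)

lemma s_self [simp]: "s m m = 0"
  using s_antisym[of m m] by linarith

lemma ip_sc_left: "x \<in> C \<Longrightarrow> y \<in> C \<Longrightarrow> ip (sc c x) y = cnj c * ip x y"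
  and ip_sc_right: "x \<in> C \<Longrightarrow> y \<in> C \<Longrightarrow> ip x (sc c y) = c * ip x y"
  by (simp_all add: B_simps)

text \<open>The letters applied so far travel with the vector because the phase depends on them.
  Vectors off the carrier are left alone, so that the steps commute on the whole type, as folding
  over a multiset needs.\<close>

definition step :: "'i \<Rightarrow> 'i multiset \<times> 'h \<Rightarrow> 'i multiset \<times> 'h" where
  "step a = (\<lambda>(n, x). (add_mset a n, if x \<in> C then sc (cis (- s {#a#} n)) (T a x) else x))"

text \<open>The Weyl normalisation of the products: \<open>Tm n\<close> does not depend on the order of the
  letters in \<open>n\<close>, because the phases turn the steps into commuting maps.\<close>

definition Tm :: "'i multiset \<Rightarrow> 'h \<Rightarrow> 'h" where
  "Tm n x = snd (fold_mset step ({#}, x) n)"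

text \<open>The phases of the two orders differ by \<open>2 * \<sigma> b a\<close>, which is exactly
  what \<open>T_comm\<close> compensates.\<close>

lemma comp_fun_commute_step: "comp_fun_commute step"
proof
  fix a b
  show "step b \<circ> step a = step a \<circ> step b"
  proof
    fix nx :: "'i multiset \<times> 'h"
    obtain n x where nx: "nx = (n, x)" by (cases nx)
    have 1: "s {#b#} (add_mset a n) = \<sigma> b a + s {#b#} n" "s {#a#} (add_mset b n) = \<sigma> a b + s {#a#} n"
      using mform_add_mset_right by (metis mform_single)+
    have ph: "cis (- s {#b#} (add_mset a n)) * cis (- s {#a#} n) * cis (2 * \<sigma> b a)
         = cis (- s {#a#} (add_mset b n)) * cis (- s {#b#} n)"
      unfolding cis_mult 1 using \<sigma>_antisym[of a b] by (intro arg_cong[where f=cis]) linarith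
    show "(step b \<circ> step a) nx = (step a \<circ> step b) nx"
    proof (cases "x \<in> C")
      case True
      have "sc (cis (- s {#b#} (add_mset a n))) (T b (sc (cis (- s {#a#} n)) (T a x)))
          = sc (cis (- s {#b#} (add_mset a n)) * cis (- s {#a#} n)) (T b (T a x))"
        using True by (simp add: T_scale)
      also have "\<dots> = sc (cis (- s {#b#} (add_mset a n)) * cis (- s {#a#} n) * cis (2 * \<sigma> b a)) (T a (T b x))"
        using True by (subst T_comm) simp_all
      also have "\<dots> = sc (cis (- s {#a#} (add_mset b n))) (T a (sc (cis (- s {#b#} n)) (T b x)))"
        unfolding ph using True by (simp add: T_scale)
      finally show ?thesis using True by (simp add: nx step_def add_mset_commute)
    qed (simp add: nx step_def add_mset_commute)
  qed
qed

interpretation step: comp_fun_commute step by (rule comp_fun_commute_step)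

lemma fst_fold_step: "fst (fold_mset step ({#}, x) n) = n"
proof (induction n)
  case (add a n)
  have "fst (step a nx) = add_mset a (fst nx)" for nx :: "'i multiset \<times> 'h"
    by (simp add: step_def split_beta)
  then show ?case using add by simp
qed simp

lemma fold_step: "fold_mset step ({#}, x) n = (n, Tm n x)"
  by (simp add: Tm_def fst_fold_step prod_eq_iff)

lemma Tm_empty [simp]: "Tm {#} x = x"
  by (simp add: Tm_def)

lemma Tm_add_mset_aux: "Tm (add_mset a n) x =
    (if Tm n x \<in> C then sc (cis (- s {#a#} n)) (T a (Tm n x)) else Tm n x)"
  by (simp add: Tm_def[of "add_mset a n"] fold_step) (simp add: step_def)

lemma Tm_closed [simp, intro]: "x \<in> C \<Longrightarrow> Tm n x \<in> C"
  by (induction n) (simp_all add: Tm_add_mset_aux)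

lemma Tm_add_mset: "x \<in> C \<Longrightarrow> Tm (add_mset a n) x = sc (cis (- s {#a#} n)) (T a (Tm n x))"
  by (simp add: Tm_add_mset_aux)

lemma Tm_single: "x \<in> C \<Longrightarrow> Tm {#a#} x = T a x"
  by (simp add: Tm_add_mset)

lemma Tm_add: "x \<in> C \<Longrightarrow> y \<in> C \<Longrightarrow> Tm n (hs_add H x y) = hs_add H (Tm n x) (Tm n y)"
  by (induction n) (simp_all add: Tm_add_mset T_add hs_scale_add)

lemma Tm_scale: "x \<in> C \<Longrightarrow> Tm n (sc c x) = sc c (Tm n x)"
  by (induction n) (simp_all add: Tm_add_mset T_scale mult.commute)

lemma Tm_union: "x \<in> C \<Longrightarrow> Tm (m + n) x = sc (cis (- s m n)) (Tm m (Tm n x))"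
proof (induction m)
  case (add a m)
  have "Tm (add_mset a m + n) x = sc (cis (- s {#a#} (m + n)) * cis (- s m n)) (T a (Tm m (Tm n x)))"
    using add by (simp add: Tm_add_mset T_scale)
  also have "cis (- s {#a#} (m + n)) * cis (- s m n) = cis (- s (add_mset a m) n) * cis (- s {#a#} m)"
    unfolding cis_mult mform_add_mset_left[of _ a m n] mform_add_right by (intro arg_cong[where f=cis]) linarith
  finally show ?case using add by (simp add: Tm_add_mset)
qed simp

lemma Tm_Tm: "x \<in> C \<Longrightarrow> Tm m (Tm n x) = sc (cis (s m n)) (Tm (m + n) x)"
  by (simp add: Tm_union cis_mult)

lemma T_Tm: "x \<in> C \<Longrightarrow> T a (Tm n x) = sc (cis (s {#a#} n)) (Tm (add_mset a n) x)"
  by (simp add: Tm_add_mset cis_mult)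

section \<open>Defect forms and the resolution of the inner product into them\<close>

lemma ip_Tm_union: "x \<in> C \<Longrightarrow> y \<in> C \<Longrightarrow> ip (Tm (m + n) x) (Tm (m + n) y) = ip (Tm m (Tm n x)) (Tm m (Tm n y))"
  by (simp add: Tm_union ip_sc_left ip_sc_right cis_cnj cis_mult)

text \<open>Brehmer's alternating sum in polarised form. Sesquilinearity is what later permits
  Cauchy-Schwarz for it and sums over families of vectors.\<close>

definition Q :: "'i set \<Rightarrow> 'h \<Rightarrow> 'h \<Rightarrow> complex" where
  "Q S x y = (\<Sum>v\<in>Pow S. (-1) ^ card v * ip (Tm (mset_set v) x) (Tm (mset_set v) y))"

lemma Q_empty [simp]: "Q {} x y = ip x y"
  by (simp add: Q_def)

text \<open>Subsets of \<open>insert a S\<close> are split by whether they contain \<open>a\<close>.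
  Both arguments of the inner product acquire the same phase when \<open>a\<close> is split off, so
  no phase survives.\<close>

lemma Q_insert:
  assumes S: "finite S" "a \<notin> S" and x: "x \<in> C" and y: "y \<in> C"
  shows "Q (insert a S) x y = Q S x y - Q S (T a x) (T a y)"
proof -
  let ?f = "\<lambda>v. (-1) ^ card v * ip (Tm (mset_set v) x) (Tm (mset_set v) y)"
  have "Q (insert a S) x y = sum ?f (Pow S) + sum ?f (insert a ` Pow S)"
    unfolding Q_def Pow_insert using S by (intro sum.union_disjoint) auto
  also have "sum ?f (insert a ` Pow S) = (\<Sum>v\<in>Pow S. ?f (insert a v))"
    using S by (intro sum.reindex_cong[where l="insert a"]) (auto simp: inj_on_def)
  also have "\<dots> = (\<Sum>v\<in>Pow S. - ((-1) ^ card v * ip (Tm (mset_set v) (T a x)) (Tm (mset_set v) (T a y))))"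
  proof (rule sum.cong)
    fix v assume "v \<in> Pow S"
    then have v: "finite v" "a \<notin> v" using S finite_subset by auto
    have "mset_set (insert a v) = mset_set v + {#a#}" using v by simp
    then show "?f (insert a v) = - ((-1) ^ card v * ip (Tm (mset_set v) (T a x)) (Tm (mset_set v) (T a y)))"
      using v x y ip_Tm_union[OF x y, of "mset_set v" "{#a#}"] by (simp add: Tm_single)
  qed simp
  finally show ?thesis by (simp add: Q_def sum_negf)
qed

lemma Q_herm: "x \<in> C \<Longrightarrow> y \<in> C \<Longrightarrow> Q S x y = cnj (Q S y x)"
  unfolding Q_def cnj_sum by (intro sum.cong) (simp_all add: hs_inner_herm[symmetric])

lemma Q_add_right: "x \<in> C \<Longrightarrow> y \<in> C \<Longrightarrow> z \<in> C \<Longrightarrow> Q S x (hs_add H y z) = Q S x y + Q S x z"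
  by (simp add: Q_def Tm_add B_simps algebra_simps sum.distrib)

lemma Q_sc_right: "x \<in> C \<Longrightarrow> y \<in> C \<Longrightarrow> Q S x (sc c y) = c * Q S x y"
  by (simp add: Q_def Tm_scale B_simps sum_distrib_left mult.left_commute)

lemma Q_sc_left: "x \<in> C \<Longrightarrow> y \<in> C \<Longrightarrow> Q S (sc c x) y = cnj c * Q S x y"
  by (metis Q_herm Q_sc_right hs_scale_closed complex_cnj_mult)

lemma Q_zero_right: "x \<in> C \<Longrightarrow> Q S x (hs_zero H) = 0"
  by (metis Q_add_right add_cancel_right_right hs_add_zero zero_closed)

lemma Q_zero_left: "x \<in> C \<Longrightarrow> Q S (hs_zero H) x = 0"
  by (metis Q_herm Q_zero_right zero_closed complex_cnj_zero)

lemma T_replicate: "x \<in> C \<Longrightarrow> T a (Tm (replicate_mset j a) x) = Tm (replicate_mset (Suc j) a) x"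
proof -
  have "s {#a#} (replicate_mset j a) = 0"
  proof (induction j)
    case (Suc j)
    have "\<sigma> a a = 0" using \<sigma>_antisym[of a a] by linarith
    then show ?case using Suc by (simp add: mform_add_mset_right[of _ _ a "replicate_mset j a"] mform_single)
  qed simp
  then show "x \<in> C \<Longrightarrow> ?thesis" by (simp add: Tm_add_mset)
qed

text \<open>By \<open>Q_insert\<close> each term with \<open>i > 0\<close> is a difference of
  consecutive values of \<open>Q S\<close> along the powers of \<open>a\<close>. The term
  \<open>i = 0\<close> keeps the form of \<open>S\<close> alone and cancels the boundary term at the
  highest power.\<close>

lemma Q_telescope:
  assumes S: "finite S" "a \<notin> S" and x: "x \<in> C" and y: "y \<in> C"
  shows "(\<Sum>i\<le>j. Q (if i = 0 then S else insert a S)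
      (Tm (replicate_mset (j - i) a) x) (Tm (replicate_mset (j - i) a) y)) = Q S x y"
proof (induction j)
  case (Suc j)
  let ?X = "\<lambda>i. Tm (replicate_mset i a) x" and ?Y = "\<lambda>i. Tm (replicate_mset i a) y"
  have "(\<Sum>i\<le>Suc j. Q (if i = 0 then S else insert a S) (?X (Suc j - i)) (?Y (Suc j - i)))
      = Q S (?X (Suc j)) (?Y (Suc j)) + (\<Sum>i\<le>j. Q (insert a S) (?X (j - i)) (?Y (j - i)))"
    by (simp add: sum.atMost_Suc_shift del: sum.atMost_Suc replicate_mset_Suc)
  also have "(\<Sum>i\<le>j. Q (insert a S) (?X (j - i)) (?Y (j - i)))
      = Q (insert a S) (?X j) (?Y j) + (\<Sum>i\<in>{..j} - {0}. Q (insert a S) (?X (j - i)) (?Y (j - i)))"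
    by (subst sum.remove[of _ 0]) auto
  also have "Q (insert a S) (?X j) (?Y j) = Q S (?X j) (?Y j) - Q S (?X (Suc j)) (?Y (Suc j))"
    using S x y by (simp add: Q_insert T_replicate del: replicate_mset_Suc)
  also have "(\<Sum>i\<in>{..j} - {0}. Q (insert a S) (?X (j - i)) (?Y (j - i)))
     = (\<Sum>i\<in>{..j} - {0}. Q (if i = 0 then S else insert a S) (?X (j - i)) (?Y (j - i)))"
    by (intro sum.cong) auto
  also have "Q S (?X (Suc j)) (?Y (Suc j)) + (Q S (?X j) (?Y j) - Q S (?X (Suc j)) (?Y (Suc j)) + \<dots>)
     = (\<Sum>i\<le>j. Q (if i = 0 then S else insert a S) (?X (j - i)) (?Y (j - i)))"
    by (subst sum.remove[of "{..j}" 0]) auto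
  finally show ?case using Suc by simp
qed simp

lemma submultisets_add_replicate:
  assumes "a \<notin># r"
  shows "bij_betw (\<lambda>(p, i). p + replicate_mset i a) ({p. p \<subseteq># r} \<times> {..j}) {p. p \<subseteq># r + replicate_mset j a}"
proof (rule bij_betw_byWitness[where f' = "\<lambda>p. (filter_mset (\<lambda>b. b \<noteq> a) p, count p a)"])
  have na: "a \<notin># p" if "p \<subseteq># r" for p using assms that mset_subset_eqD by metis
  show "\<forall>pi\<in>{p. p \<subseteq># r} \<times> {..j}. (\<lambda>p. (filter_mset (\<lambda>b. b \<noteq> a) p, count p a))
      ((\<lambda>(p, i). p + replicate_mset i a) pi) = pi"
    using na by (auto simp: not_in_iff filter_mset_eq_conv multiset_eq_iff)
  show "\<forall>p\<in>{p. p \<subseteq># r + replicate_mset j a}. (\<lambda>(p, i). p + replicate_mset i a)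
      (filter_mset (\<lambda>b. b \<noteq> a) p, count p a) = p"
    by (auto simp: multiset_eq_iff)
  show "(\<lambda>(p, i). p + replicate_mset i a) ` ({p. p \<subseteq># r} \<times> {..j}) \<subseteq> {p. p \<subseteq># r + replicate_mset j a}"
    by (auto simp: subseteq_mset_def add_mono)
  show "(\<lambda>p. (filter_mset (\<lambda>b. b \<noteq> a) p, count p a)) ` {p. p \<subseteq># r + replicate_mset j a}
      \<subseteq> {p. p \<subseteq># r} \<times> {..j}"
  proof (clarsimp, intro conjI)
    fix p assume p: "p \<subseteq># r + replicate_mset j a"
    then have le: "count p b \<le> count r b + (if b = a then j else 0)" for b
      using mset_subset_eq_count[OF p, of b] by (simp split: if_splits)
    show "filter_mset (\<lambda>b. b \<noteq> a) p \<subseteq># r"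
    proof (rule mset_subset_eqI)
      show "count (filter_mset (\<lambda>b. b \<noteq> a) p) b \<le> count r b" for b
        using le[of b] by auto
    qed
    show "count p a \<le> j" using le[of a] assms by (simp add: not_in_iff)
  qed
qed

lemma finite_submultisets: "finite {p. p \<subseteq># r}"
proof (induction r)
  case (add a r)
  have "{p. p \<subseteq># add_mset a r} \<subseteq> {p. p \<subseteq># r} \<union> add_mset a ` {p. p \<subseteq># r}"
  proof
    fix p assume "p \<in> {p. p \<subseteq># add_mset a r}"
    then have p: "p \<subseteq># add_mset a r" by simp
    show "p \<in> {p. p \<subseteq># r} \<union> add_mset a ` {p. p \<subseteq># r}"
    proof (cases "a \<in># p")
      case True
      then obtain p' where "p = add_mset a p'" by (blast dest: multi_member_split)
      then show ?thesis using p by simp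
    next
      case False
      then have "p \<subseteq># r" using p
        by (metis add_mset_add_single diff_single_trivial subset_eq_diff_conv)
      then show ?thesis by simp
    qed
  qed
  then show ?case using add finite_subset by blast
qed simp

text \<open>For \<open>S = {}\<close> this resolves the inner product into defect forms. Only the
  support of \<open>p\<close> selects the form, so all copies of one letter are treated together by
  \<open>Q_telescope\<close>, and the induction runs over the number of distinct letters.\<close>

lemma Q_defect_sum:
  assumes "finite S" "S \<inter> set_mset r = {}" "x \<in> C" "y \<in> C"
  shows "(\<Sum>p\<in>{p. p \<subseteq># r}. Q (S \<union> set_mset p) (Tm (r - p) x) (Tm (r - p) y)) = Q S x y"
  using assms
proof (induction "card (set_mset r)" arbitrary: r S)
  case 0
  then show ?case by simp
next
  case (Suc k)
  then obtain a where a: "a \<in># r" by (metis card.empty equals0I old.nat.distinct(2))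
  define r' where "r' = filter_mset (\<lambda>b. b \<noteq> a) r"
  define j where "j = count r a"
  have r: "r = r' + replicate_mset j a"
    by (auto simp: r'_def j_def multiset_eq_iff)
  have ar': "a \<notin># r'" by (simp add: r'_def)
  have set_r': "set_mset r' = set_mset r - {a}" by (auto simp: r'_def)
  have k: "k = card (set_mset r')" using Suc(2) a by (simp add: set_r')
  have aS: "a \<notin> S" using a Suc(4) by auto
  note x = Suc(5) and y = Suc(6)
  have "(\<Sum>p\<in>{p. p \<subseteq># r}. Q (S \<union> set_mset p) (Tm (r - p) x) (Tm (r - p) y))
    = (\<Sum>(p, i)\<in>{p. p \<subseteq># r'} \<times> {..j}. Q (S \<union> set_mset (p + replicate_mset i a))
        (Tm (r - (p + replicate_mset i a)) x) (Tm (r - (p + replicate_mset i a)) y))"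
    unfolding r by (subst sum.reindex_bij_betw[OF submultisets_add_replicate[OF ar'], symmetric])
      (simp add: split_beta)
  also have "\<dots> = (\<Sum>p\<in>{p. p \<subseteq># r'}. \<Sum>i\<le>j. Q (S \<union> set_mset (p + replicate_mset i a))
        (Tm (r - (p + replicate_mset i a)) x) (Tm (r - (p + replicate_mset i a)) y))"
    by (simp add: sum.cartesian_product)
  also have "\<dots> = (\<Sum>p\<in>{p. p \<subseteq># r'}. Q (S \<union> set_mset p) (Tm (r' - p) x) (Tm (r' - p) y))"
  proof (intro sum.cong refl)
    fix p assume "p \<in> {p. p \<subseteq># r'}"
    then have p: "p \<subseteq># r'" by simp
    then have ap: "a \<notin># p" using ar' mset_subset_eqD by metis
    have "(\<Sum>i\<le>j. Q (S \<union> set_mset (p + replicate_mset i a))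
        (Tm (r - (p + replicate_mset i a)) x) (Tm (r - (p + replicate_mset i a)) y))
      = (\<Sum>i\<le>j. Q (if i = 0 then S \<union> set_mset p else insert a (S \<union> set_mset p))
      (Tm (replicate_mset (j - i) a) (Tm (r' - p) x)) (Tm (replicate_mset (j - i) a) (Tm (r' - p) y)))"
    proof (intro sum.cong refl)
      fix i assume "i \<in> {..j}"
      then have i: "i \<le> j" by simp
      have "r - (p + replicate_mset i a) = replicate_mset (j - i) a + (r' - p)"
        unfolding r multiset_eq_iff
      proof
        fix b
        have "count p b \<le> count r' b" using p by (simp add: subseteq_mset_def)
        moreover have "count p a = 0" "count r' a = 0" using ap ar' by (simp_all add: not_in_iff)
        ultimately show "count (r' + replicate_mset j a - (p + replicate_mset i a)) b
          = count (replicate_mset (j - i) a + (r' - p)) b" using i by auto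
      qed
      moreover have "S \<union> set_mset (p + replicate_mset i a)
          = (if i = 0 then S \<union> set_mset p else insert a (S \<union> set_mset p))"
        by auto
      ultimately show "Q (S \<union> set_mset (p + replicate_mset i a))
          (Tm (r - (p + replicate_mset i a)) x) (Tm (r - (p + replicate_mset i a)) y)
        = Q (if i = 0 then S \<union> set_mset p else insert a (S \<union> set_mset p))
          (Tm (replicate_mset (j - i) a) (Tm (r' - p) x)) (Tm (replicate_mset (j - i) a) (Tm (r' - p) y))"
        using x y by (simp add: Tm_union Q_sc_left Q_sc_right cis_cnj cis_mult flip: mult.assoc)
    qed
    also have "\<dots> = Q (S \<union> set_mset p) (Tm (r' - p) x) (Tm (r' - p) y)"
      by (rule Q_telescope) (use Suc(3) aS ap x y in auto)
    finally show "(\<Sum>i\<le>j. Q (S \<union> set_mset (p + replicate_mset i a))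
        (Tm (r - (p + replicate_mset i a)) x) (Tm (r - (p + replicate_mset i a)) y))
      = Q (S \<union> set_mset p) (Tm (r' - p) x) (Tm (r' - p) y)" .
  qed
  also have "\<dots> = Q S x y"
    by (rule Suc(1)[OF k Suc(3) _ x y]) (use Suc(4) set_r' in auto)
  finally show ?case .
qed

end

section \<open>The dilation kernel\<close>

lemma sum_list_double_swap:
  fixes f :: "'a \<Rightarrow> 'b \<Rightarrow> complex"
  shows "(\<Sum>x\<leftarrow>xs. \<Sum>y\<leftarrow>ys. f x y) = (\<Sum>y\<leftarrow>ys. \<Sum>x\<leftarrow>xs. f x y)"
  by (induction xs) (simp_all add: sum_list_addf)

lemma cnj_sum_list: "cnj (\<Sum>x\<leftarrow>xs. f x) = (\<Sum>x\<leftarrow>xs. cnj (f x))"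
  by (induction xs) simp_all

lemma sum_list_sum_swap:
  fixes f :: "'a \<Rightarrow> 'b \<Rightarrow> complex"
  shows "(\<Sum>x\<leftarrow>xs. \<Sum>p\<in>P. f x p) = (\<Sum>p\<in>P. \<Sum>x\<leftarrow>xs. f x p)"
  by (induction xs) (simp_all add: sum.distrib)

locale brehmer_family = twisted_family H T \<sigma>
  for H :: "'h chs" and T :: "'i \<Rightarrow> 'h \<Rightarrow> 'h" and \<sigma> +
  assumes brehmer: "finite S \<Longrightarrow> x \<in> hs_carrier H \<Longrightarrow> 0 \<le> Re (Q S x x)"
begin

text \<open>The triple \<open>(t, m, x)\<close> stands for the vector \<open>U (m - t) x\<close> of the dilation space, where \<open>U\<close> is
  the Weyl-normalised projective representation of the free abelian group over the letters.
  Different triples may denote the same vector.\<close>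

definition kern :: "'i multiset \<times> 'i multiset \<times> 'h \<Rightarrow> 'i multiset \<times> 'i multiset \<times> 'h \<Rightarrow> complex" where
  "kern z w = (case z of (t, m, x) \<Rightarrow> case w of (t', n, y) \<Rightarrow>
     cis (s (m + t' - (n + t)) (n + t - (m + t')) - (s m n - s m t' - s t n + s t t'))
     * ip (Tm (m + t' - (n + t)) x) (Tm (n + t - (m + t')) y))"

definition valid :: "'i multiset \<times> 'i multiset \<times> 'h \<Rightarrow> bool" where
  "valid z \<longleftrightarrow> snd (snd z) \<in> C"

definition gsc :: "complex \<Rightarrow> 'i multiset \<times> 'i multiset \<times> 'h \<Rightarrow> 'i multiset \<times> 'i multiset \<times> 'h" where
  "gsc c = (\<lambda>(t, m, x). (t, m, sc c x))"

text \<open>The action of \<open>U a\<close> on triples; the phase is the cocycle exponent of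
  \<open>{#a#}\<close> against the difference of \<open>m\<close> and \<open>t\<close>.\<close>

definition fwd :: "'i \<Rightarrow> 'i multiset \<times> 'i multiset \<times> 'h \<Rightarrow> 'i multiset \<times> 'i multiset \<times> 'h" where
  "fwd a = (\<lambda>(t, m, x). (t, add_mset a m, sc (cis (s {#a#} m - s {#a#} t)) x))"

text \<open>The inverse letter enlarges the subtracted part instead of removing \<open>a\<close>
  from \<open>m\<close>, so no case distinction on whether \<open>a\<close> occurs there
  arises.\<close>

definition bwd :: "'i \<Rightarrow> 'i multiset \<times> 'i multiset \<times> 'h \<Rightarrow> 'i multiset \<times> 'i multiset \<times> 'h" where
  "bwd a = (\<lambda>(t, m, x). (add_mset a t, m, sc (cis (s {#a#} t - s {#a#} m)) x))"

lemma valid_simps [simp]: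
  "valid (t, m, x) \<longleftrightarrow> x \<in> C" "valid z \<Longrightarrow> valid (gsc c z)"
  "valid z \<Longrightarrow> valid (fwd a z)" "valid z \<Longrightarrow> valid (bwd a z)"
  by (auto simp: valid_def gsc_def fwd_def bwd_def split: prod.splits)

lemma kern_herm:
  assumes "valid z" "valid w" shows "kern z w = cnj (kern w z)"
proof -
  obtain t m x t' n y where zw: "z = (t, m, x)" "w = (t', n, y)" by (metis prod_cases3)
  let ?d = "m + t' - (n + t)" and ?e = "n + t - (m + t')"
  have "s ?d ?e - (s m n - s m t' - s t n + s t t') = - (s ?e ?d - (s n m - s n t - s t' m + s t' t))"
    using s_antisym[of ?d ?e] s_antisym[of m n] s_antisym[of m t'] s_antisym[of t n] s_antisym[of t t'] by linarith
  then have ph: "cis (s ?d ?e - (s m n - s m t' - s t n + s t t'))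
     = cnj (cis (s ?e ?d - (s n m - s n t - s t' m + s t' t)))"
    by (simp add: cis_cnj)
  have "ip (Tm ?d x) (Tm ?e y) = cnj (ip (Tm ?e y) (Tm ?d x))"
    using assms by (intro hs_inner_herm) (auto simp: zw)
  then show ?thesis unfolding zw kern_def prod.case ph by (simp only: complex_cnj_mult)
qed

lemma kern_gsc_right: "valid z \<Longrightarrow> valid w \<Longrightarrow> kern z (gsc c w) = c * kern z w"
  by (cases z rule: prod_cases3; cases w rule: prod_cases3) (simp add: kern_def gsc_def Tm_scale ip_sc_right)

lemma kern_add_right:
  "valid z \<Longrightarrow> x \<in> C \<Longrightarrow> y \<in> C \<Longrightarrow> kern z (t, n, hs_add H x y) = kern z (t, n, x) + kern z (t, n, y)"
  by (cases z rule: prod_cases3) (simp add: kern_def Tm_add hs_inner_add distrib_left)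

text \<open>Enlarging \<open>t\<close> on the left and enlarging \<open>n\<close> on the right give
  the same sum \<open>n + t\<close>, hence the same disjoint parts; only the phases have to be
  compared.\<close>

lemma kern_bwd_fwd:
  assumes "valid z" "valid w" shows "kern (bwd a z) w = kern z (fwd a w)"
proof -
  obtain t m x t' n y where zw: "z = (t, m, x)" "w = (t', n, y)" by (metis prod_cases3)
  let ?d = "m + t' - (add_mset a n + t)" and ?e = "add_mset a n + t - (m + t')"
  have A: "s (add_mset a t) n = s {#a#} n + s t n" "s (add_mset a t) t' = s {#a#} t' + s t t'"
    by (rule mform_add_mset_left)+
  have B: "s m (add_mset a n) = s m {#a#} + s m n" "s t (add_mset a n) = s t {#a#} + s t n"
    by (rule mform_add_mset_right)+
  have ph: "cis (s ?d ?e - (s m n - s m t' - s (add_mset a t) n + s (add_mset a t) t'))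
        * cis (s {#a#} m - s {#a#} t)
      = cis (s ?d ?e - (s m (add_mset a n) - s m t' - s t (add_mset a n) + s t t'))
        * cis (s {#a#} n - s {#a#} t')"
    unfolding cis_mult A B using s_antisym[of m "{#a#}"] s_antisym[of t "{#a#}"]
    by (intro arg_cong[where f=cis]) linarith
  have "kern (bwd a z) w = cis (s ?d ?e - (s m n - s m t' - s (add_mset a t) n + s (add_mset a t) t'))
        * cis (s {#a#} m - s {#a#} t) * ip (Tm ?d x) (Tm ?e y)"
    using assms by (simp add: zw kern_def bwd_def Tm_scale ip_sc_left cis_cnj)
  also have "\<dots> = kern z (fwd a w)"
    unfolding ph using assms by (simp add: zw kern_def fwd_def Tm_scale ip_sc_right)
  finally show ?thesis .
qed

lemma fwd_bwd: "valid (t, m, x) \<Longrightarrow> fwd a (bwd a (t, m, x)) = (add_mset a t, add_mset a m, x)"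
  and bwd_fwd: "valid (t, m, x) \<Longrightarrow> bwd a (fwd a (t, m, x)) = (add_mset a t, add_mset a m, x)"
  using mform_add_mset_right[of \<sigma> "{#a#}" a m] mform_add_mset_right[of \<sigma> "{#a#}" a t]
  by (simp_all add: fwd_def bwd_def cis_mult)

text \<open>Makes \<open>fwd a\<close> and \<open>bwd a\<close> mutually inverse as far as the
  kernel sees: both composites enlarge \<open>t\<close> and \<open>m\<close> by \<open>a\<close>,
  which leaves their difference alone.\<close>

lemma kern_translate:
  assumes "x \<in> C" "valid w"
  shows "kern (add_mset a t, add_mset a m, x) w = kern (t, m, x) w"
proof -
  obtain t' n y where w: "w = (t', n, y)" by (metis prod_cases3)
  have "s (add_mset a m) n - s (add_mset a m) t' - s (add_mset a t) n + s (add_mset a t) t'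
      = s m n - s m t' - s t n + s t t'"
    by (simp add: mform_add_mset_left[of _ a m] mform_add_mset_left[of _ a t])
  then show ?thesis by (simp add: w kern_def)
qed

lemma bwd_comm: "valid z \<Longrightarrow> bwd b (bwd a z) = gsc (cis (- (2 * \<sigma> a b))) (bwd a (bwd b z))"
proof -
  assume z: "valid z"
  obtain t m x where zw: "z = (t, m, x)" by (metis prod_cases3)
  have A: "s {#b#} (add_mset a t) = \<sigma> b a + s {#b#} t" "s {#a#} (add_mset b t) = \<sigma> a b + s {#a#} t"
    by (simp_all add: mform_add_mset_right[of _ _ _ t] mform_single)
  have "cis (s {#b#} (add_mset a t) - s {#b#} m) * cis (s {#a#} t - s {#a#} m)
    = cis (- (2 * \<sigma> a b)) * (cis (s {#a#} (add_mset b t) - s {#a#} m) * cis (s {#b#} t - s {#b#} m))"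
    unfolding cis_mult A using \<sigma>_antisym[of a b] by (intro arg_cong[where f=cis]) linarith
  then show ?thesis using z by (simp add: zw bwd_def gsc_def add_mset_commute)
qed

text \<open>The case without subtracted parts. The common part of \<open>M\<close> and
  \<open>N\<close> is resolved by \<open>Q_defect_sum\<close>, applied to the vectors already moved
  by the disjoint remainders; the Weyl relation then merges the products into
  \<open>Tm (M - p)\<close> and \<open>Tm (N - p)\<close>.\<close>

lemma kern_plus_expansion:
  fixes M N :: "'i multiset"
  assumes x: "x \<in> C" and y: "y \<in> C"
  shows "cis (s (M - N) (N - M) - s M N) * ip (Tm (M - N) x) (Tm (N - M) y)
    = (\<Sum>p\<in>{p. p \<subseteq># M \<inter># N}. Q (set_mset p) (sc (cis (- s p M)) (Tm (M - p) x)) (sc (cis (- s p N)) (Tm (N - p) y)))"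
proof -
  define r d e where "r = M \<inter># N" and "d = M - N" and "e = N - M"
  have M: "M = r + d" and N: "N = r + e" by (auto simp: r_def d_def e_def multiset_eq_iff)
  have "cis (s d e - s M N) * ip (Tm d x) (Tm e y)
    = (\<Sum>p\<in>{p. p \<subseteq># r}. cis (s d e - s M N) * Q (set_mset p) (Tm (r - p) (Tm d x)) (Tm (r - p) (Tm e y)))"
    using Q_defect_sum[of "{}" r "Tm d x" "Tm e y"] x y by (simp flip: sum_distrib_left)
  also have "\<dots> = (\<Sum>p\<in>{p. p \<subseteq># r}. Q (set_mset p) (sc (cis (- s p M)) (Tm (M - p) x)) (sc (cis (- s p N)) (Tm (N - p) y)))"
  proof (intro sum.cong refl)
    fix p assume "p \<in> {p. p \<subseteq># r}"
    then obtain c where r: "r = p + c" by (auto simp: mset_subset_eq_exists_conv)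
    have Mp: "M - p = c + d" and Np: "N - p = c + e" and rp: "r - p = c" by (simp_all add: M N r)
    \<comment> \<open>The decisive splitting: the total phase is a term in \<open>p\<close> and
      \<open>M\<close> minus the same term in \<open>p\<close> and \<open>N\<close>, so each side
      can absorb its own share.\<close>
    have "(s d e - s M N) - s c d + s c e = s p M - s p N"
      unfolding M N r mform_add_left mform_add_right
      using s_antisym[of c p] s_antisym[of d p] s_antisym[of d c] s_self[of p] s_self[of c] by linarith
    then have ph: "cis (s d e - s M N) * cnj (cis (s c d)) * cis (s c e) = cnj (cis (- s p M)) * cis (- s p N)"
      by (simp add: cis_cnj cis_mult)
    show "cis (s d e - s M N) * Q (set_mset p) (Tm (r - p) (Tm d x)) (Tm (r - p) (Tm e y))
      = Q (set_mset p) (sc (cis (- s p M)) (Tm (M - p) x)) (sc (cis (- s p N)) (Tm (N - p) y))"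
      unfolding rp Mp Np using x y arg_cong[OF ph, of "\<lambda>u. u * Q (set_mset p) (Tm (c + d) x) (Tm (c + e) y)"]
      by (simp add: Tm_Tm Q_sc_left Q_sc_right mult_ac)
  qed
  finally show ?thesis by (simp add: r_def d_def e_def)
qed

text \<open>Here \<open>\<tau>\<close> bounds all subtracted parts of a finite family, and
  \<open>m + (\<tau> - t)\<close> is the exponent after the shift by \<open>\<tau>\<close>; the
  phase \<open>s \<tau> m - s \<tau> t\<close> is caused by this shift. The zero vector for the
  remaining \<open>p\<close> allows one index set for all pairs.\<close>

definition defect_vec :: "'i multiset \<Rightarrow> 'i multiset \<Rightarrow> 'i multiset \<times> 'i multiset \<times> 'h \<Rightarrow> 'h" where
  "defect_vec \<tau> p = (\<lambda>(t, m, x). if p \<subseteq># m + (\<tau> - t)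
     then sc (cis (s \<tau> m - s \<tau> t - s p (m + (\<tau> - t)))) (Tm (m + (\<tau> - t) - p) x) else hs_zero H)"

lemma defect_vec_closed: "valid z \<Longrightarrow> defect_vec \<tau> p z \<in> C"
  by (cases z) (simp add: defect_vec_def)

lemma kern_expansion:
  assumes z: "valid (t, m, x)" and w: "valid (t', n, y)" and t: "t \<subseteq># \<tau>" "t' \<subseteq># \<tau>"
    and \<rho>: "m + (\<tau> - t) \<subseteq># \<rho>"
  shows "kern (t, m, x) (t', n, y) = (\<Sum>p\<in>{p. p \<subseteq># \<rho>}. Q (set_mset p) (defect_vec \<tau> p (t, m, x)) (defect_vec \<tau> p (t', n, y)))"
proof -
  obtain c where c: "\<tau> = t + c" using t(1) by (auto simp: mset_subset_eq_exists_conv)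
  obtain c' where c': "\<tau> = t' + c'" using t(2) by (auto simp: mset_subset_eq_exists_conv)
  define M N where "M = m + (\<tau> - t)" and "N = n + (\<tau> - t')"
  have M: "M = m + c" by (simp add: M_def c)
  have N: "N = n + c'" by (simp add: N_def c')
  \<comment> \<open>Cancelling \<open>t + t'\<close> on one side and \<open>\<tau>\<close> on the
    other identifies the disjoint parts before and after the shift.\<close>
  have "M + (t + t') = (m + t') + \<tau>" by (simp add: M c ac_simps)
  moreover have "N + (t + t') = (n + t) + \<tau>" by (simp add: N c' ac_simps)
  ultimately have MN: "M + (t + t') = (m + t') + \<tau>" "N + (t + t') = (n + t) + \<tau>" .
  have d: "m + t' - (n + t) = M - N" and e: "n + t - (m + t') = N - M"
    using MN by (metis add_diff_cancel_right)+
  have sc1: "s c v = s \<tau> v - s t v" for v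
    by (simp add: c mform_add_left)
  have sc2: "s v c' = s v \<tau> - s v t'" for v
    by (simp add: c' mform_add_right)
  have "s M N = s \<tau> n - s \<tau> t' - s \<tau> m + s \<tau> t + (s m n - s m t' - s t n + s t t')"
    unfolding M N mform_add_left mform_add_right sc1 sc2
    using s_antisym[of m \<tau>] s_antisym[of t \<tau>] s_self[of \<tau>] by linarith
  then have ph: "cis (s (M - N) (N - M) - (s m n - s m t' - s t n + s t t'))
     = cnj (cis (s \<tau> m - s \<tau> t)) * cis (s \<tau> n - s \<tau> t') * cis (s (M - N) (N - M) - s M N)"
    unfolding cis_cnj cis_mult by (intro arg_cong[where f=cis]) linarith
  have "kern (t, m, x) (t', n, y) = cnj (cis (s \<tau> m - s \<tau> t)) * cis (s \<tau> n - s \<tau> t')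
     * (\<Sum>p\<in>{p. p \<subseteq># M \<inter># N}. Q (set_mset p) (sc (cis (- s p M)) (Tm (M - p) x)) (sc (cis (- s p N)) (Tm (N - p) y)))"
    using z w kern_plus_expansion[of x y M N, symmetric] unfolding kern_def prod.case d e ph by simp
  also have "\<dots> = (\<Sum>p\<in>{p. p \<subseteq># M \<inter># N}. Q (set_mset p) (defect_vec \<tau> p (t, m, x)) (defect_vec \<tau> p (t', n, y)))"
    unfolding sum_distrib_left
  proof (intro sum.cong refl)
    fix p assume "p \<in> {p. p \<subseteq># M \<inter># N}"
    then have p: "p \<subseteq># M" "p \<subseteq># N" by simp_all
    have 1: "defect_vec \<tau> p (t, m, x) = sc (cis (s \<tau> m - s \<tau> t)) (sc (cis (- s p M)) (Tm (M - p) x))"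
      using p z by (simp add: defect_vec_def M_def[symmetric] cis_mult)
    have 2: "defect_vec \<tau> p (t', n, y) = sc (cis (s \<tau> n - s \<tau> t')) (sc (cis (- s p N)) (Tm (N - p) y))"
      using p w by (simp add: defect_vec_def N_def[symmetric] cis_mult)
    show "cnj (cis (s \<tau> m - s \<tau> t)) * cis (s \<tau> n - s \<tau> t')
        * Q (set_mset p) (sc (cis (- s p M)) (Tm (M - p) x)) (sc (cis (- s p N)) (Tm (N - p) y))
      = Q (set_mset p) (defect_vec \<tau> p (t, m, x)) (defect_vec \<tau> p (t', n, y))"
      unfolding 1 2 using z w by (subst Q_sc_left, simp, simp, subst Q_sc_right) (simp_all del: hs_scale_scale)
  qed
  \<comment> \<open>The added terms vanish by the default value of \<open>defect_vec\<close>: there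
    \<open>p\<close> fails to lie below \<open>M\<close> or below \<open>N\<close>.\<close>
  also have "\<dots> = (\<Sum>p\<in>{p. p \<subseteq># \<rho>}. Q (set_mset p) (defect_vec \<tau> p (t, m, x)) (defect_vec \<tau> p (t', n, y)))"
  proof (rule sum.mono_neutral_left)
    show "finite {p. p \<subseteq># \<rho>}" by (rule finite_submultisets)
    show "{p. p \<subseteq># M \<inter># N} \<subseteq> {p. p \<subseteq># \<rho>}"
      using \<rho> unfolding M_def by (auto intro: subset_mset.order_trans)
    show "\<forall>p\<in>{p. p \<subseteq># \<rho>} - {p. p \<subseteq># M \<inter># N}.
        Q (set_mset p) (defect_vec \<tau> p (t, m, x)) (defect_vec \<tau> p (t', n, y)) = 0"
    proof
      fix p assume "p \<in> {p. p \<subseteq># \<rho>} - {p. p \<subseteq># M \<inter># N}"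
      then have "\<not> p \<subseteq># M \<or> \<not> p \<subseteq># N" by simp
      then have "defect_vec \<tau> p (t, m, x) = hs_zero H \<or> defect_vec \<tau> p (t', n, y) = hs_zero H"
        by (auto simp: defect_vec_def M_def N_def)
      then show "Q (set_mset p) (defect_vec \<tau> p (t, m, x)) (defect_vec \<tau> p (t', n, y)) = 0"
        using Q_zero_left Q_zero_right defect_vec_closed[OF z] defect_vec_closed[OF w] by auto
    qed
  qed
  finally show ?thesis .
qed

lemma kern_positive:
  assumes "\<forall>z\<in>set zs. valid z"
  shows "0 \<le> Re (\<Sum>z\<leftarrow>zs. \<Sum>w\<leftarrow>zs. kern z w)"
proof -
  \<comment> \<open>Sums over the whole list serve as common upper bounds, so one
    \<open>\<tau>\<close> and one range of \<open>p\<close> work for every pair.\<close>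
  define \<tau> where "\<tau> = (\<Sum>z\<leftarrow>zs. fst z)"
  define \<rho> where "\<rho> = (\<Sum>z\<leftarrow>zs. fst (snd z) + (\<tau> - fst z))"
  have sub: "f z \<subseteq># (\<Sum>z\<leftarrow>zs. f z)" if "z \<in> set zs" for z and f :: "_ \<Rightarrow> 'i multiset"
    using that by (induction zs) (auto intro: subset_mset.order_trans)
  have kern: "kern z w = (\<Sum>p\<in>{p. p \<subseteq># \<rho>}. Q (set_mset p) (defect_vec \<tau> p z) (defect_vec \<tau> p w))"
    if "z \<in> set zs" "w \<in> set zs" for z w
  proof -
    obtain t m x t' n y where zw: "z = (t, m, x)" "w = (t', n, y)" by (metis prod_cases3)
    show ?thesis
      unfolding zw
    proof (rule kern_expansion)
      show "t \<subseteq># \<tau>" "t' \<subseteq># \<tau>" using sub[of z fst] sub[of w fst] that by (simp_all add: zw \<tau>_def)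
      show "m + (\<tau> - t) \<subseteq># \<rho>"
        using sub[of z "\<lambda>z. fst (snd z) + (\<tau> - fst z)"] that by (simp add: zw \<rho>_def)
    qed (use assms that in \<open>auto simp: zw\<close>)
  qed
  have "(\<Sum>z\<leftarrow>zs. \<Sum>w\<leftarrow>zs. kern z w)
    = (\<Sum>z\<leftarrow>zs. \<Sum>w\<leftarrow>zs. \<Sum>p\<in>{p. p \<subseteq># \<rho>}. Q (set_mset p) (defect_vec \<tau> p z) (defect_vec \<tau> p w))"
    by (intro arg_cong[where f=sum_list] map_cong refl) (simp add: kern)
  also have "\<dots> = (\<Sum>p\<in>{p. p \<subseteq># \<rho>}. \<Sum>z\<leftarrow>zs. \<Sum>w\<leftarrow>zs. Q (set_mset p) (defect_vec \<tau> p z) (defect_vec \<tau> p w))"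
    by (simp add: sum_list_sum_swap)
  also have "Re \<dots> = (\<Sum>p\<in>{p. p \<subseteq># \<rho>}. Re (\<Sum>z\<leftarrow>zs. \<Sum>w\<leftarrow>zs. Q (set_mset p) (defect_vec \<tau> p z) (defect_vec \<tau> p w)))"
    by (rule Re_sum)
  also have "\<dots> \<ge> 0"
  proof (rule sum_nonneg)
    fix p
    interpret q: semi_ip C "hs_add H" sc "Q (set_mset p)"
      by unfold_locales (auto simp: Q_add_right Q_sc_right brehmer Q_herm[symmetric])
    have "set (map (defect_vec \<tau> p) zs) \<subseteq> C" using assms defect_vec_closed by auto
    from q.double_sum_nonneg[OF this]
    show "0 \<le> Re (\<Sum>z\<leftarrow>zs. \<Sum>w\<leftarrow>zs. Q (set_mset p) (defect_vec \<tau> p z) (defect_vec \<tau> p w))"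
      by (simp add: comp_def)
  qed
  finally show ?thesis .
qed

section \<open>The dilation space and its unitaries\<close>

abbreviation "gens \<equiv> {zs. \<forall>z\<in>set zs. valid z}"

definition gform :: "('i multiset \<times> 'i multiset \<times> 'h) list \<Rightarrow> ('i multiset \<times> 'i multiset \<times> 'h) list \<Rightarrow> complex" where
  "gform zs ws = (\<Sum>z\<leftarrow>zs. \<Sum>w\<leftarrow>ws. kern z w)"

lemma gform_cong:
  assumes "length zs = length zs'" "length ws = length ws'"
    and "\<And>i j. i < length zs \<Longrightarrow> j < length ws \<Longrightarrow> kern (zs ! i) (ws ! j) = kern (zs' ! i) (ws' ! j)"
  shows "gform zs ws = gform zs' ws'"
proof -
  have "gform zs ws = (\<Sum>i = 0..<length zs. \<Sum>j = 0..<length ws. kern (zs ! i) (ws ! j))"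
    by (simp add: gform_def sum_list_sum_nth)
  also have "\<dots> = (\<Sum>i = 0..<length zs. \<Sum>j = 0..<length ws. kern (zs' ! i) (ws' ! j))"
    by (intro sum.cong refl assms(3)) auto
  finally show ?thesis by (simp add: gform_def sum_list_sum_nth assms(1,2))
qed

text \<open>Formal sums are lists of triples, added by concatenation. Distinct lists may denote the
  same vector; the functionals of the completion identify them.\<close>

sublocale gen: semi_ip gens append "\<lambda>c. map (gsc c)" gform
proof
  show "gens \<noteq> {}" by (auto intro: exI[of _ "[]"])
  fix xs ys zs c
  assume xs: "xs \<in> gens"
  show "map (gsc c) xs \<in> gens" using xs by auto
  show "0 \<le> Re (gform xs xs)" using kern_positive xs by (simp add: gform_def)
  assume ys: "ys \<in> gens"
  show "xs @ ys \<in> gens" using xs ys by auto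
  show "gform xs (ys @ zs) = gform xs ys + gform xs zs" by (simp add: gform_def sum_list_addf)
  have "gform xs (map (gsc c) ys) = (\<Sum>z\<leftarrow>xs. \<Sum>w\<leftarrow>ys. c * kern z w)"
    unfolding gform_def map_map comp_def using xs ys
    by (intro arg_cong[where f=sum_list] map_cong refl kern_gsc_right) auto
  then show "gform xs (map (gsc c) ys) = c * gform xs ys"
    by (simp add: gform_def sum_list_const_mult)
  have "gform xs ys = (\<Sum>z\<leftarrow>xs. \<Sum>w\<leftarrow>ys. cnj (kern w z))"
    unfolding gform_def using xs ys by (intro arg_cong[where f=sum_list] map_cong refl kern_herm) auto
  then show "gform xs ys = cnj (gform ys xs)"
    by (simp add: gform_def cnj_sum_list sum_list_double_swap[of _ xs ys])
qed

definition emb1 :: "'i multiset \<Rightarrow> 'h \<Rightarrow> ('i multiset \<times> 'i multiset \<times> 'h) list \<Rightarrow> complex" where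
  "emb1 n x = gen.emb [({#}, n, x)]"

text \<open>\<open>lift\<close> takes the adjoint of the map it extends, so \<open>bwd a\<close>
  here yields the extension of \<open>fwd a\<close>.\<close>

definition U :: "'i \<Rightarrow> (('i multiset \<times> 'i multiset \<times> 'h) list \<Rightarrow> complex) \<Rightarrow> _" where
  "U a = gen.lift (map (bwd a))"

lemma gform_bwd_fwd: "zs \<in> gens \<Longrightarrow> ws \<in> gens \<Longrightarrow> gform (map (bwd a) zs) ws = gform zs (map (fwd a) ws)"
  by (rule gform_cong) (auto simp: kern_bwd_fwd)

lemma U_unitary: "chs_unitary gen.cpl (U a)"
  unfolding U_def
proof (rule gen.lift_unitary[where u = "map (fwd a)"])
  fix zs ws assume z: "zs \<in> gens" and w: "ws \<in> gens"
  have V: "valid (zs ! i)" "valid (ws ! j)" if "i < length zs" "j < length ws" for i j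
    using z w that by auto
  have 1: "kern (fwd a (bwd a (zs ! i))) (ws ! j) = kern (zs ! i) (ws ! j)"
    and 2: "kern (bwd a (fwd a (zs ! i))) (ws ! j) = kern (zs ! i) (ws ! j)"
    if "i < length zs" "j < length ws" for i j
    using V[OF that] by (cases "zs ! i"; simp add: fwd_bwd bwd_fwd kern_translate)+
  show "gform (map (fwd a) (map (bwd a) zs)) ws = gform zs ws"
    by (rule gform_cong) (simp_all add: 1)
  show "gform (map (bwd a) (map (fwd a) zs)) ws = gform zs ws"
    by (rule gform_cong) (simp_all add: 2)
  show "gform (map (bwd a) zs) ws = gform zs (map (fwd a) ws)" by (rule gform_bwd_fwd[OF z w])
qed auto

lemma U_comm:
  assumes "f \<in> hs_carrier gen.cpl"
  shows "U a (U b f) = hs_scale gen.cpl (cis (2 * \<sigma> a b)) (U b (U a f))"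
proof
  fix zs
  obtain r where r: "gen.rep r f" using assms by (auto simp: gen.cpl_def)
  show "U a (U b f) zs = hs_scale gen.cpl (cis (2 * \<sigma> a b)) (U b (U a f)) zs"
  proof (cases "zs \<in> gens")
    case True
    \<comment> \<open>Precomposition reverses the order of the two letters, and antilinearity of
      \<open>f\<close> conjugates the phase of \<open>bwd_comm\<close>; together they give the
      required sign.\<close>
    have "map (bwd b) (map (bwd a) zs) = map (gsc (cis (- (2 * \<sigma> a b)))) (map (bwd a) (map (bwd b) zs))"
      unfolding map_map comp_def using True by (intro map_cong refl bwd_comm) auto
    moreover have "map (bwd a) (map (bwd b) zs) \<in> gens" using True by auto
    ultimately have "f (map (bwd b) (map (bwd a) zs)) = cis (2 * \<sigma> a b) * f (map (bwd a) (map (bwd b) zs))"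
      using gen.rep_val_smul[OF r, of "map (bwd a) (map (bwd b) zs)" "cis (- (2 * \<sigma> a b))"] by (simp only: cis_cnj minus_minus)
    then show ?thesis using True by (simp add: U_def gen.lift_def gen.cpl_def)
  qed (auto simp: U_def gen.lift_def gen.cpl_def)
qed

lemma U_emb1: "x \<in> C \<Longrightarrow> U a (emb1 n x) = emb1 (add_mset a n) (sc (cis (s {#a#} n)) x)"
  unfolding U_def emb1_def
  by (subst gen.lift_emb[where u = "map (fwd a)"]) (auto simp: gform_bwd_fwd, simp add: fwd_def)

lemma emb1_closed: "x \<in> C \<Longrightarrow> emb1 n x \<in> hs_carrier gen.cpl"
  unfolding emb1_def by (rule gen.emb_in_cpl) simp

text \<open>Against the index \<open>{#}\<close> the disjoint parts are \<open>{#}\<close> and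
  \<open>n\<close> and all phases vanish: this is the compression identity in weak form.\<close>

lemma cip_emb1:
  assumes "x \<in> C" "y \<in> C"
  shows "hs_inner gen.cpl (emb1 {#} x) (emb1 n y) = ip x (Tm n y)"
proof -
  have "hs_inner gen.cpl (emb1 {#} x) (emb1 n y) = gform [({#}, {#}, x)] [({#}, n, y)]"
    unfolding gen.cpl_def emb1_def using assms
    by (simp, subst gen.cip_emb[OF gen.rep_emb]) (simp_all add: gen.emb_def)
  then show ?thesis by (simp add: gform_def kern_def)
qed

lemma emb1_embedding: "hs_embedding H gen.cpl (emb1 {#})"
proof -
  have "emb1 {#} (hs_add H x y) = hs_add gen.cpl (emb1 {#} x) (emb1 {#} y)" if "x \<in> C" "y \<in> C" for x y
  proof
    fix zs
    have "(\<Sum>z\<leftarrow>zs. kern z ({#}, {#}, hs_add H x y)) = (\<Sum>z\<leftarrow>zs. kern z ({#}, {#}, x)) + (\<Sum>z\<leftarrow>zs. kern z ({#}, {#}, y))"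
      if zs: "zs \<in> gens"
    proof -
      have "(\<Sum>z\<leftarrow>zs. kern z ({#}, {#}, hs_add H x y)) = (\<Sum>z\<leftarrow>zs. kern z ({#}, {#}, x) + kern z ({#}, {#}, y))"
        using zs \<open>x \<in> C\<close> \<open>y \<in> C\<close> by (intro arg_cong[where f=sum_list] map_cong refl kern_add_right) auto
      then show ?thesis by (simp add: sum_list_addf)
    qed
    then show "emb1 {#} (hs_add H x y) zs = hs_add gen.cpl (emb1 {#} x) (emb1 {#} y) zs"
      by (auto simp: gen.cpl_def emb1_def gen.emb_def gform_def)
  qed
  moreover have "emb1 {#} (sc c x) = hs_scale gen.cpl c (emb1 {#} x)" if "x \<in> C" for c x
  proof
    fix zs
    have "gform zs [({#}, {#}, sc c x)] = c * gform zs [({#}, {#}, x)]" if "zs \<in> gens"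
      using gen.B_smul_right[OF that, of "[({#}, {#}, x)]" c] \<open>x \<in> C\<close> by (simp add: gsc_def)
    then show "emb1 {#} (sc c x) zs = hs_scale gen.cpl c (emb1 {#} x) zs"
      by (simp add: gen.cpl_def emb1_def gen.emb_def)
  qed
  ultimately show ?thesis
    by (simp add: hs_embedding_def hs_linear_def emb1_closed cip_emb1)
qed

text \<open>Each letter contributes the same phase on both sides, by \<open>U_emb1\<close> and
  \<open>T_Tm\<close>, so the accumulated phase can stay hidden in the witness
  \<open>x'\<close>.\<close>

lemma word_op_emb1:
  assumes "x \<in> C"
  shows "\<exists>n x'. x' \<in> C \<and> word_op U ws (emb1 {#} x) = emb1 n x' \<and> word_op T ws x = Tm n x'"
proof (induction ws)
  case Nil
  show ?case using assms by (auto simp: word_op_def intro!: exI[of _ "{#}"] exI[of _ x])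
next
  case (Cons w ws)
  obtain a k where w: "w = (a, k)" by (cases w)
  have U: "word_op U (w # ws) y = (U a ^^ k) (word_op U ws y)" for y by (simp add: word_op_def w)
  have T: "word_op T (w # ws) y = (T a ^^ k) (word_op T ws y)" for y by (simp add: word_op_def w)
  show ?case unfolding U T
  proof (induction k)
    case 0
    then show ?case using Cons by simp
  next
    case (Suc k)
    then obtain n x' where n: "x' \<in> C" "(U a ^^ k) (word_op U ws (emb1 {#} x)) = emb1 n x'"
      "(T a ^^ k) (word_op T ws x) = Tm n x'" by blast
    then show ?case
      by (intro exI[of _ "add_mset a n"] exI[of _ "sc (cis (s {#a#} n)) x'"]) (simp add: U_emb1 T_Tm Tm_scale)
  qed
qed

lemma word_op_weak_dilation:
  assumes "x \<in> C" "y \<in> C"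
  shows "hs_inner gen.cpl (emb1 {#} x) (word_op U ws (emb1 {#} y)) = ip x (word_op T ws y)"
    and "word_op U ws (emb1 {#} y) \<in> hs_carrier gen.cpl"
    and "word_op T ws y \<in> C"
  using word_op_emb1[OF assms(2), of ws] assms(1) by (auto simp: cip_emb1 emb1_closed)

end

section \<open>Realisation on the prescribed type\<close>

context inner_space
begin

lemma inner_eqI:
  assumes u: "u \<in> hs_carrier S" and v: "v \<in> hs_carrier S"
    and eq: "\<And>x. x \<in> hs_carrier S \<Longrightarrow> hs_inner S x u = hs_inner S x v"
  shows "u = v"
proof -
  have "hs_inner S (sub u v) (sub u v) = 0" using u v by (simp add: B_sub_right eq)
  then have zero: "hs_add S u (hs_scale S (-1) v) = hs_zero S"
    using hs_inner_definite[of "sub u v"] u v by (simp add: sub_def)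
  have "u = hs_add S u (hs_add S (hs_scale S (-1) v) v)"
    using u v hs_add_neg[OF v] hs_add_commute[of v "hs_scale S (-1) v"] by simp
  also have "\<dots> = hs_add S (hs_zero S) v" using u v by (simp add: hs_add_assoc[symmetric] zero)
  also have "\<dots> = v" using v hs_add_commute[of "hs_zero S" v] by simp
  finally show ?thesis .
qed

lemma inner_zero_right [simp]: "x \<in> hs_carrier S \<Longrightarrow> hs_inner S x (hs_zero S) = 0"
  using hs_inner_add[of x "hs_zero S" "hs_zero S"] by (metis add_cancel_right_right hs_add_zero zero_closed)

lemma scale_zero_right [simp]: "hs_scale S c (hs_zero S) = hs_zero S"
  by (rule inner_eqI) (simp_all add: B_simps)

lemma scale_zero_left: "x \<in> hs_carrier S \<Longrightarrow> hs_scale S 0 x = hs_zero S"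
  by (rule inner_eqI) (simp_all add: B_simps)

text \<open>Converts an identity tested against the vectors \<open>J x\<close> into the description
  of \<open>orth_proj\<close> by a unique vector. Uniqueness reduces to \<open>inner_eqI\<close> in
  \<open>H\<close>, since \<open>J\<close> preserves inner products.\<close>

lemma orth_proj_eq:
  assumes "inner_space H" and J: "hs_embedding H S J"
    and w: "w \<in> hs_carrier H" and W: "W \<in> hs_carrier S"
    and weak: "\<And>x. x \<in> hs_carrier H \<Longrightarrow> hs_inner S (J x) W = hs_inner H x w"
  shows "orth_proj S (J ` hs_carrier H) W = J w"
  unfolding orth_proj_def
proof (rule the_equality)
  interpret H: inner_space H by fact
  have JC: "J x \<in> hs_carrier S" if "x \<in> hs_carrier H" for x
    using J that by (simp add: hs_embedding_def hs_linear_def)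
  have Jip: "hs_inner S (J x) (J y) = hs_inner H x y" if "x \<in> hs_carrier H" "y \<in> hs_carrier H" for x y
    using J that by (simp add: hs_embedding_def)
  have weak': "hs_inner S W (J x) = hs_inner H w x" if "x \<in> hs_carrier H" for x
    using weak[OF that] hs_inner_herm[OF W JC[OF that]] H.hs_inner_herm[OF w that] by simp
  show "J w \<in> J ` hs_carrier H \<and> (\<forall>z\<in>J ` hs_carrier H. hs_inner S (hs_minus S W (J w)) z = 0)"
    using w W JC by (auto simp: sub_eq[symmetric] B_sub_left weak' Jip)
  fix y assume y: "y \<in> J ` hs_carrier H \<and> (\<forall>z\<in>J ` hs_carrier H. hs_inner S (hs_minus S W y) z = 0)"
  then obtain v where v: "v \<in> hs_carrier H" "y = J v" by blast
  have "v = w"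
  proof (rule H.inner_eqI[OF v(1) w])
    fix x assume x: "x \<in> hs_carrier H"
    have "hs_inner S (sub W (J v)) (J x) = 0" using y v x by (auto simp: sub_eq)
    then have "hs_inner H w x = hs_inner H v x" using x v W JC by (simp add: B_sub_left weak' Jip)
    then show "hs_inner H x v = hs_inner H x w"
      using H.hs_inner_herm[OF x v(1)] H.hs_inner_herm[OF x w] by simp
  qed
  then show "y = J w" by (simp add: v)
qed

end

section \<open>Transport of structure along an injection\<close>

definition chs_image :: "('a \<Rightarrow> 'b) \<Rightarrow> 'a chs \<Rightarrow> 'b chs" where
  "chs_image \<iota> S = (let r = inv_into (hs_carrier S) \<iota> in
     \<lparr>hs_carrier = \<iota> ` hs_carrier S, hs_add = (\<lambda>x y. \<iota> (hs_add S (r x) (r y))), hs_zero = \<iota> (hs_zero S),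
      hs_scale = (\<lambda>c x. \<iota> (hs_scale S c (r x))), hs_inner = (\<lambda>x y. hs_inner S (r x) (r y))\<rparr>)"

locale chs_transport = inner_space S for S :: "'a chs" +
  fixes \<iota> :: "'a \<Rightarrow> 'b"
  assumes inj: "inj_on \<iota> (hs_carrier S)"
begin

abbreviation "K \<equiv> chs_image \<iota> S"
abbreviation "r \<equiv> inv_into (hs_carrier S) \<iota>"

lemma r_\<iota> [simp]: "x \<in> hs_carrier S \<Longrightarrow> r (\<iota> x) = x"
  using inj by simp

lemma carrier_image: "hs_carrier K = \<iota> ` hs_carrier S"
  by (simp add: chs_image_def Let_def)

lemma image_simps [simp]:
  "hs_zero K = \<iota> (hs_zero S)"
  "x \<in> hs_carrier S \<Longrightarrow> y \<in> hs_carrier S \<Longrightarrow> hs_add K (\<iota> x) (\<iota> y) = \<iota> (hs_add S x y)"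
  "x \<in> hs_carrier S \<Longrightarrow> hs_scale K c (\<iota> x) = \<iota> (hs_scale S c x)"
  "x \<in> hs_carrier S \<Longrightarrow> y \<in> hs_carrier S \<Longrightarrow> hs_inner K (\<iota> x) (\<iota> y) = hs_inner S x y"
  by (simp_all add: chs_image_def Let_def)

lemma norm_image [simp]: "x \<in> hs_carrier S \<Longrightarrow> hs_norm K (\<iota> x) = hs_norm S x"
  by (simp add: hs_norm_def)

lemma minus_image [simp]:
  "x \<in> hs_carrier S \<Longrightarrow> y \<in> hs_carrier S \<Longrightarrow> hs_minus K (\<iota> x) (\<iota> y) = \<iota> (hs_minus S x y)"
  by (simp add: hs_minus_def)

lemma inner_space_image: "inner_space K"
proof (unfold_locales, unfold carrier_image ball_simps)
  show "\<forall>x\<in>hs_carrier S. \<forall>y\<in>hs_carrier S. hs_add K (\<iota> x) (\<iota> y) = hs_add K (\<iota> y) (\<iota> x)"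
    by (simp add: hs_add_commute)
  show "\<forall>x\<in>hs_carrier S. \<forall>y\<in>hs_carrier S. hs_inner K (\<iota> x) (\<iota> y) = cnj (hs_inner K (\<iota> y) (\<iota> x))"
    by (simp add: hs_inner_herm[symmetric])
qed (auto simp: hs_add_assoc hs_add_neg hs_scale_add hs_add_scale hs_inner_add hs_inner_scale hs_inner_nonneg
     dest: hs_inner_definite)

lemma chs_hilbert_image:
  assumes "chs_complete S" shows "chs_hilbert K"
proof -
  have "chs_complete K"
    unfolding chs_complete_def
  proof (intro allI impI, elim conjE)
    fix s :: "nat \<Rightarrow> 'b" assume s: "\<forall>n. s n \<in> hs_carrier K"
      and cau: "\<forall>e>0. \<exists>M. \<forall>m\<ge>M. \<forall>n\<ge>M. hs_norm K (hs_minus K (s m) (s n)) < e"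
    define t where "t n = r (s n)" for n
    have t: "t n \<in> hs_carrier S" and s_t: "s n = \<iota> (t n)" for n
      using s[rule_format, of n] by (auto simp: t_def carrier_image)
    have "\<forall>e>0. \<exists>M. \<forall>m\<ge>M. \<forall>n\<ge>M. hs_norm S (hs_minus S (t m) (t n)) < e"
      using cau by (simp add: s_t t sub_eq[symmetric])
    then obtain x where x: "x \<in> hs_carrier S" "\<forall>e>0. \<exists>M. \<forall>n\<ge>M. hs_norm S (hs_minus S (t n) x) < e"
      using assms[unfolded chs_complete_def, rule_format, of t] t by blast
    show "\<exists>x\<in>hs_carrier K. \<forall>e>0. \<exists>M. \<forall>n\<ge>M. hs_norm K (hs_minus K (s n) x) < e"
      using x by (intro bexI[of _ "\<iota> x"]) (simp_all add: s_t t carrier_image sub_eq[symmetric])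
  qed
  then show ?thesis using inner_space_image by (simp add: chs_hilbert_iff)
qed

definition tr :: "('a \<Rightarrow> 'a) \<Rightarrow> 'b \<Rightarrow> 'b" where "tr U = \<iota> \<circ> U \<circ> r"

lemma tr_\<iota> [simp]: "x \<in> hs_carrier S \<Longrightarrow> tr U (\<iota> x) = \<iota> (U x)"
  by (simp add: tr_def)

lemma unitary_image:
  assumes "chs_unitary S U" shows "chs_unitary K (tr U)"
proof -
  have U: "U x \<in> hs_carrier S" if "x \<in> hs_carrier S" for x
    using assms that by (simp add: chs_unitary_def chs_isometry_def hs_linear_def)
  have "hs_linear K K (tr U)"
    using assms U by (auto simp: chs_unitary_def chs_isometry_def hs_linear_def carrier_image)
  moreover have "\<forall>x\<in>hs_carrier K. hs_norm K (tr U x) = hs_norm K x"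
    using assms U by (auto simp: chs_unitary_def chs_isometry_def carrier_image)
  moreover have "tr U ` hs_carrier K = \<iota> ` U ` hs_carrier S"
    unfolding carrier_image image_image by (intro image_cong) simp_all
  ultimately show ?thesis
    using assms by (simp add: chs_unitary_def chs_isometry_def carrier_image)
qed

lemma embedding_image:
  assumes "hs_embedding H S J" shows "hs_embedding H K (\<iota> \<circ> J)"
proof -
  have "J x \<in> hs_carrier S" if "x \<in> hs_carrier H" for x
    using assms that by (simp add: hs_embedding_def hs_linear_def)
  then show ?thesis using assms by (simp add: hs_embedding_def hs_linear_def carrier_image)
qed

lemma word_op_image:
  assumes U: "\<And>a x. a \<in> set (map fst ws) \<Longrightarrow> x \<in> hs_carrier S \<Longrightarrow> U a x \<in> hs_carrier S" and x: "x \<in> hs_carrier S"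
  shows "word_op (\<lambda>a. tr (U a)) ws (\<iota> x) = \<iota> (word_op U ws x) \<and> word_op U ws x \<in> hs_carrier S"
  using U
proof (induction ws)
  case Nil
  show ?case using x by (simp add: word_op_def)
next
  case (Cons w ws)
  obtain a k where w: "w = (a, k)" by (cases w)
  let ?y = "word_op U ws x"
  have IH: "word_op (\<lambda>a. tr (U a)) ws (\<iota> x) = \<iota> ?y" "?y \<in> hs_carrier S" using Cons by simp_all
  have Ua: "U a z \<in> hs_carrier S" if "z \<in> hs_carrier S" for z
    using Cons(2)[of a z] that by (simp add: w)
  have "(tr (U a) ^^ k) (\<iota> ?y) = \<iota> ((U a ^^ k) ?y) \<and> (U a ^^ k) ?y \<in> hs_carrier S"
    by (induction k) (simp_all add: IH(2) Ua)
  then show ?case using IH by (simp add: word_op_def w)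
qed

end

text \<open>The type fixed by the theorem has one entry per index, whereas a representing sequence
  has a list of generators there. Pairing of natural numbers spreads the \<open>n\<close>-th list
  over the positions \<open>(n, j)\<close>.\<close>

lemma ex_inj_list_sequences:
  fixes g :: "'g \<Rightarrow> 'a list \<times> 'b"
  assumes "inj g"
  shows "\<exists>enc :: (nat \<Rightarrow> 'g list) \<Rightarrow> nat \<Rightarrow> 'a list \<times> 'b. inj enc"
proof -
  txt \<open>Position \<open>(n, 0)\<close> stores the length of the \<open>n\<close>-th list in unary, which makes the padding harmless.\<close>
  define enc :: "(nat \<Rightarrow> 'g list) \<Rightarrow> nat \<Rightarrow> 'a list \<times> 'b" where
    "enc s k = (case prod_decode k of (n, j) \<Rightarrow> case j of 0 \<Rightarrow> (replicate (length (s n)) undefined, undefined)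
       | Suc i \<Rightarrow> if i < length (s n) then g (s n ! i) else undefined)" for s k
  have "inj enc"
  proof (rule injI, rule ext)
    fix s t :: "nat \<Rightarrow> 'g list" and n assume eq: "enc s = enc t"
    have "enc s (prod_encode (n, 0)) = enc t (prod_encode (n, 0))" by (simp add: eq)
    then have len: "length (s n) = length (t n)"
      by (simp add: enc_def)
    show "s n = t n"
    proof (rule nth_equalityI[OF len])
      fix i assume i: "i < length (s n)"
      have "enc s (prod_encode (n, Suc i)) = enc t (prod_encode (n, Suc i))" by (simp add: eq)
      then show "s n ! i = t n ! i" using i len injD[OF assms] by (simp add: enc_def)
    qed
  qed
  then show ?thesis by blast
qed

text \<open>The integer is a tag, 0 for letters of \<open>t\<close> and 1 for letters of
  \<open>m\<close>, so that one list stores both multisets; \<open>lst\<close> fixes an ordering of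
  each.\<close>

lemma ex_inj_generators:
  "\<exists>g :: 'i multiset \<times> 'i multiset \<times> 'h \<Rightarrow> ('i \<times> int) list \<times> 'h. inj g"
proof -
  obtain lst :: "'i multiset \<Rightarrow> 'i list" where lst: "\<And>n. mset (lst n) = n"
    using ex_mset by metis
  define g :: "'i multiset \<times> 'i multiset \<times> 'h \<Rightarrow> ('i \<times> int) list \<times> 'h" where
    "g = (\<lambda>(t, m, x). (map (\<lambda>a. (a, 0)) (lst t) @ map (\<lambda>a. (a, 1)) (lst m), x))"
  have f0: "filter (\<lambda>p. snd p = k) (map (\<lambda>a. (a, l)) xs) = (if k = l then map (\<lambda>a. (a, l)) xs else [])"
    for k l :: int and xs :: "'i list"
    by (induction xs) auto
  have "inj g"
  proof (rule injI)
    fix z w assume eq: "g z = g w"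
    obtain t m x t' n y where zw: "z = (t, m, x)" "w = (t', n, y)" by (metis prod_cases3)
    let ?l = "\<lambda>t m. map (\<lambda>a. (a, 0::int)) (lst t) @ map (\<lambda>a. (a, 1)) (lst m)"
    have l: "?l t m = ?l t' n" and xy: "x = y" using eq by (simp_all add: g_def zw)
    have "lst t = lst t'"
      using arg_cong[OF l, of "\<lambda>l. map fst (filter (\<lambda>p. snd p = 0) l)"] by (simp add: f0 comp_def)
    moreover have "lst m = lst n"
      using arg_cong[OF l, of "\<lambda>l. map fst (filter (\<lambda>p. snd p = 1) l)"] by (simp add: f0 comp_def)
    ultimately show "z = w" using lst xy zw by metis
  qed
  then show ?thesis by blast
qed

text \<open>A sequence determines the functional as its limit. Functionals, whose type is not the
  prescribed one, can thus be replaced by sequences, which can be encoded in it.\<close>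

lemma (in semi_ip) inj_on_rp: "inj_on rp (hs_carrier cpl)"
proof (rule inj_onI)
  fix f g assume f: "f \<in> hs_carrier cpl" and g: "g \<in> hs_carrier cpl" and eq: "rp f = rp g"
  have "rep (rp f) f" "rep (rp g) g" using f g rep_rp by (auto simp: cpl_def)
  then have R: "rep (rp f) f" "rep (rp f) g" by (simp_all add: eq)
  show "f = g"
  proof
    fix z show "f z = g z"
      using LIMSEQ_unique[OF rep_lim[OF R(1)] rep_lim[OF R(2)]] rep_off[OF R(1)] rep_off[OF R(2)]
      by (cases "z \<in> V") auto
  qed
qed

lemma (in brehmer_family) ex_unitary_dilation:
  "\<exists>(K :: (nat \<Rightarrow> ('i \<times> int) list \<times> 'h) chs) J U.
     chs_hilbert K \<and> hs_embedding H K J \<and> (\<forall>a. chs_unitary K (U a)) \<and>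
     (\<forall>a b. \<forall>y\<in>hs_carrier K. U a (U b y) = hs_scale K (cis (2 * \<sigma> a b)) (U b (U a y))) \<and>
     (\<forall>ws. \<forall>x\<in>C. J (word_op T ws x) = orth_proj K (J ` C) (word_op U ws (J x)))"
proof -
  obtain g :: "'i multiset \<times> 'i multiset \<times> 'h \<Rightarrow> ('i \<times> int) list \<times> 'h" where "inj g"
    using ex_inj_generators by blast
  then obtain enc :: "(nat \<Rightarrow> ('i multiset \<times> 'i multiset \<times> 'h) list) \<Rightarrow> nat \<Rightarrow> ('i \<times> int) list \<times> 'h"
    where enc: "inj enc" using ex_inj_list_sequences by blast
  define \<iota> where "\<iota> = enc \<circ> gen.rp"
  have "inj_on \<iota> (hs_carrier gen.cpl)"
    unfolding \<iota>_def using gen.inj_on_rp enc by (intro comp_inj_on) (auto intro: inj_on_subset)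
  moreover have cpl: "inner_space gen.cpl" "chs_complete gen.cpl"
    using gen.chs_hilbert_cpl by (simp_all add: chs_hilbert_iff)
  ultimately interpret tr: chs_transport gen.cpl \<iota>
    by (simp add: chs_transport_def chs_transport_axioms_def)
  interpret K: inner_space tr.K by (rule tr.inner_space_image)
  have Uc: "U a f \<in> hs_carrier gen.cpl" if "f \<in> hs_carrier gen.cpl" for a f
    using U_unitary[of a] that by (simp add: chs_unitary_def chs_isometry_def hs_linear_def)
  define J where "J = \<iota> \<circ> emb1 {#}"
  have emb: "hs_embedding H tr.K J"
    unfolding J_def by (rule tr.embedding_image[OF emb1_embedding])
  have proj: "orth_proj tr.K (J ` C) (word_op (\<lambda>a. tr.tr (U a)) ws (J x)) = J (word_op T ws x)" if x: "x \<in> C" for ws x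
  proof (rule K.orth_proj_eq[OF _ emb])
    show "inner_space H" by unfold_locales
    have W: "word_op (\<lambda>a. tr.tr (U a)) ws (J x) = \<iota> (word_op U ws (emb1 {#} x))"
      using tr.word_op_image[of ws U "emb1 {#} x"] Uc emb1_closed[OF x] by (simp add: J_def)
    show "word_op T ws x \<in> C" by (rule word_op_weak_dilation(3)[OF x x])
    note wc = word_op_weak_dilation(2)[OF x x]
    show "word_op (\<lambda>a. tr.tr (U a)) ws (J x) \<in> hs_carrier tr.K"
      unfolding W tr.carrier_image using wc by blast
    show "hs_inner tr.K (J y) (word_op (\<lambda>a. tr.tr (U a)) ws (J x)) = ip y (word_op T ws x)" if "y \<in> C" for y
      unfolding W using word_op_weak_dilation(1)[OF that x] wc emb1_closed[OF that] by (simp add: J_def)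
  qed
  have comm: "\<forall>a b. \<forall>y\<in>hs_carrier tr.K. tr.tr (U a) (tr.tr (U b) y)
      = hs_scale tr.K (cis (2 * \<sigma> a b)) (tr.tr (U b) (tr.tr (U a) y))"
  proof (intro allI ballI)
    fix a b y assume "y \<in> hs_carrier tr.K"
    then obtain f where f: "f \<in> hs_carrier gen.cpl" "y = \<iota> f" unfolding tr.carrier_image by blast
    have "tr.tr (U a) (tr.tr (U b) y) = \<iota> (U a (U b f))" by (simp add: f Uc)
    also have "\<dots> = \<iota> (hs_scale gen.cpl (cis (2 * \<sigma> a b)) (U b (U a f)))" by (simp only: U_comm[OF f(1), of a b])
    also have "\<dots> = hs_scale tr.K (cis (2 * \<sigma> a b)) (tr.tr (U b) (tr.tr (U a) y))" by (simp add: f Uc)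
    finally show "tr.tr (U a) (tr.tr (U b) y) = hs_scale tr.K (cis (2 * \<sigma> a b)) (tr.tr (U b) (tr.tr (U a) y))" .
  qed
  show ?thesis
  proof (rule exI[of _ tr.K], rule exI[of _ J], rule exI[of _ "\<lambda>a. tr.tr (U a)"], intro conjI)
    show "chs_hilbert tr.K" by (rule tr.chs_hilbert_image[OF cpl(2)])
    show "hs_embedding H tr.K J" by (rule emb)
    show "\<forall>a. chs_unitary tr.K (tr.tr (U a))" by (intro allI tr.unitary_image U_unitary)
      show "\<forall>ws. \<forall>x\<in>C. J (word_op T ws x) = orth_proj tr.K (J ` C) (word_op (\<lambda>a. tr.tr (U a)) ws (J x))"
      by (simp add: proj)
  qed (rule comm)
qed

section \<open>The three sufficient conditions\<close>

lemma quadratic_nonneg_linear_zero: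
  fixes \<alpha> \<beta> :: real
  assumes \<beta>: "0 \<le> \<beta>" and q: "\<And>t. 0 \<le> 2 * t * \<alpha> + t\<^sup>2 * \<beta>"
  shows "\<alpha> = 0"
proof (rule ccontr)
  assume "\<alpha> \<noteq> 0"
  then have pos: "0 < \<alpha>\<^sup>2" by simp
  \<comment> \<open>For positive \<open>\<beta>\<close> the minimum is at
    \<open>- \<alpha> / \<beta>\<close>; adding 1 to the denominator covers
    \<open>\<beta> = 0\<close> and still gives a negative value.\<close>
  have "2 * (- \<alpha> / (\<beta> + 1)) * \<alpha> + (- \<alpha> / (\<beta> + 1))\<^sup>2 * \<beta> = - \<alpha>\<^sup>2 * (\<beta> + 2) / (\<beta> + 1)\<^sup>2"
    using \<beta> by (simp add: divide_simps power2_eq_square) (simp add: algebra_simps)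
  also have "\<dots> < 0" using pos \<beta> by (intro divide_neg_pos) (auto simp: mult_neg_pos)
  finally show False using q[of "- \<alpha> / (\<beta> + 1)"] by linarith
qed

context inner_space
begin

lemma parallelogram_mid:
  assumes "x \<in> hs_carrier S" "y \<in> hs_carrier S"
  shows "(N (hs_scale S (1/2) (hs_add S x y)))\<^sup>2 = (N x)\<^sup>2 / 2 + (N y)\<^sup>2 / 2 - (N (sub x y))\<^sup>2 / 4"
  using assms by (simp add: N_square B_sub_left B_sub_right B_simps field_simps)

text \<open>Minimises \<open>F\<close>, which for a representing vector \<open>z\<close> equals
  \<open>(N (sub x z))\<^sup>2 - (N z)\<^sup>2\<close>; the vanishing first variation at the limit
  of a minimising sequence is the representation.\<close>

lemma riesz:
  assumes complete: "chs_complete S"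
    and add: "\<And>x y. x \<in> hs_carrier S \<Longrightarrow> y \<in> hs_carrier S \<Longrightarrow> \<phi> (hs_add S x y) = \<phi> x + \<phi> y"
    and scale: "\<And>c x. x \<in> hs_carrier S \<Longrightarrow> \<phi> (hs_scale S c x) = c * \<phi> x"
    and bound: "\<And>x. x \<in> hs_carrier S \<Longrightarrow> cmod (\<phi> x) \<le> b * N x"
  obtains z where "z \<in> hs_carrier S" "\<And>x. x \<in> hs_carrier S \<Longrightarrow> \<phi> x = hs_inner S z x"
proof -
  define F where "F x = (N x)\<^sup>2 - 2 * Re (\<phi> x)" for x
  define I where "I = Inf (F ` hs_carrier S)"
  have lower: "- b\<^sup>2 \<le> F x" if x: "x \<in> hs_carrier S" for x
  proof -
    have "Re (\<phi> x) \<le> b * N x" using bound[OF x] complex_Re_le_cmod[of "\<phi> x"] by linarith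
    moreover have "0 \<le> (N x - b)\<^sup>2" by simp
    ultimately show ?thesis by (simp add: F_def power2_diff mult.commute)
  qed
  have bdd: "bdd_below (F ` hs_carrier S)" using lower by (auto intro!: bdd_belowI)
  have I_le: "I \<le> F x" if "x \<in> hs_carrier S" for x
    unfolding I_def using bdd that by (intro cINF_lower)
  have "\<exists>x\<in>hs_carrier S. F x < I + 1 / real (Suc n)" for n
  proof -
    have "\<exists>y\<in>F ` hs_carrier S. y < I + 1 / real (Suc n)"
      unfolding I_def using V_nonempty bdd by (intro cInf_lessD) (auto simp: I_def[symmetric])
    then show ?thesis by blast
  qed
  then obtain x where xC: "\<And>n. x n \<in> hs_carrier S" and Fx: "\<And>n. F (x n) < I + 1 / real (Suc n)"
    by metis
  \<comment> \<open>By the parallelogram law the midpoint of two near minimisers would fall below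
    the infimum unless they are close.\<close>
  have dist: "(N (sub (x m) (x n)))\<^sup>2 < 2 * (1 / real (Suc m)) + 2 * (1 / real (Suc n))" for m n
  proof -
    let ?z = "hs_scale S (1/2) (hs_add S (x m) (x n))"
    have "Re (\<phi> ?z) = (Re (\<phi> (x m)) + Re (\<phi> (x n))) / 2" using xC by (simp add: add scale)
    then have "F ?z = F (x m) / 2 + F (x n) / 2 - (N (sub (x m) (x n)))\<^sup>2 / 4"
      unfolding F_def parallelogram_mid[OF xC xC] by simp argo
    moreover have "I \<le> F ?z" using xC by (intro I_le) auto
    ultimately show ?thesis using Fx[of m] Fx[of n] by linarith
  qed
  have "\<forall>e>0. \<exists>M. \<forall>m\<ge>M. \<forall>n\<ge>M. hs_norm S (hs_minus S (x m) (x n)) < e"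
  proof (intro allI impI)
    fix e :: real assume e: "0 < e"
    then have "0 < e\<^sup>2 / 4" by simp
    then obtain M where M: "1 / real (Suc M) < e\<^sup>2 / 4" using nat_approx_posE by blast
    have le: "1 / real (Suc n) < e\<^sup>2 / 4" if "n \<ge> M" for n
    proof -
      have "1 / real (Suc n) \<le> 1 / real (Suc M)" using that by (simp add: frac_le)
      then show ?thesis using M by linarith
    qed
    show "\<exists>M. \<forall>m\<ge>M. \<forall>n\<ge>M. hs_norm S (hs_minus S (x m) (x n)) < e"
    proof (intro exI allI impI)
      fix m n assume "M \<le> m" "M \<le> n"
      then have "(N (sub (x m) (x n)))\<^sup>2 < e\<^sup>2" using dist[of m n] le[of m] le[of n] by linarith
      then show "hs_norm S (hs_minus S (x m) (x n)) < e"
        using e by (simp add: power2_less_imp_less N_eq[symmetric] sub_eq[symmetric])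
    qed
  qed
  then obtain z where z: "z \<in> hs_carrier S"
    and lim: "\<And>e. e > 0 \<Longrightarrow> \<exists>M. \<forall>n\<ge>M. hs_norm S (hs_minus S (x n) z) < e"
    using complete[unfolded chs_complete_def, rule_format, of x] xC by blast
  have N_lim: "(\<lambda>n. N (sub (x n) z)) \<longlonglongrightarrow> 0"
    unfolding LIMSEQ_iff using lim xC z by (simp add: N_eq[symmetric] sub_eq[symmetric])
  have ip_lim: "(\<lambda>n. hs_inner S (x n) w) \<longlonglongrightarrow> hs_inner S z w" if w: "w \<in> hs_carrier S" for w
  proof -
    have "(\<lambda>n. hs_inner S (sub (x n) z) w) \<longlonglongrightarrow> 0"
    proof (rule Lim_null_comparison)
      show "\<forall>\<^sub>F n in sequentially. cmod (hs_inner S (sub (x n) z) w) \<le> N (sub (x n) z) * N w"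
        using cauchy_schwarz xC z w by simp
      show "(\<lambda>n. N (sub (x n) z) * N w) \<longlonglongrightarrow> 0" using tendsto_mult_left_zero[OF N_lim] .
    qed
    then have "(\<lambda>n. hs_inner S (x n) w - hs_inner S z w) \<longlonglongrightarrow> 0"
      using xC z w by (simp add: B_sub_left)
    then show ?thesis by (simp add: LIM_zero_iff)
  qed
  have Re_eq: "Re (hs_inner S z w - \<phi> w) = 0" if w: "w \<in> hs_carrier S" for w
  proof (rule quadratic_nonneg_linear_zero)
    show "0 \<le> (N w)\<^sup>2" by simp
    fix t :: real
    \<comment> \<open>The perturbation is applied to the minimising sequence, at the cost of a
      vanishing error, so that only inner products have to be passed to the limit.\<close>
    have ineq: "- (1 / real (Suc n)) \<le> 2 * t * (Re (hs_inner S (x n) w) - Re (\<phi> w)) + t\<^sup>2 * (N w)\<^sup>2" for n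
    proof -
      let ?y = "hs_add S (x n) (hs_scale S (of_real t) w)"
      have h: "Re (hs_inner S w (x n)) = Re (hs_inner S (x n) w)"
        using hs_inner_herm[OF w xC, of n] by simp
      have "I \<le> F ?y" using xC w by (intro I_le) auto
      moreover have "F ?y = F (x n) + 2 * t * (Re (hs_inner S (x n) w) - Re (\<phi> w)) + t\<^sup>2 * (N w)\<^sup>2"
        using xC w by (simp add: F_def N_square B_simps add scale h power2_eq_square[of t] algebra_simps)
      ultimately show ?thesis using Fx[of n] by linarith
    qed
    have "(\<lambda>n. - (1 / real (Suc n))) \<longlonglongrightarrow> - 0"
      by (intro tendsto_minus) (rule LIMSEQ_Suc[OF lim_1_over_n])
    moreover have "(\<lambda>n. 2 * t * (Re (hs_inner S (x n) w) - Re (\<phi> w)) + t\<^sup>2 * (N w)\<^sup>2)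
      \<longlonglongrightarrow> 2 * t * (Re (hs_inner S z w) - Re (\<phi> w)) + t\<^sup>2 * (N w)\<^sup>2"
      by (intro tendsto_intros ip_lim w)
    ultimately have "- 0 \<le> 2 * t * (Re (hs_inner S z w) - Re (\<phi> w)) + t\<^sup>2 * (N w)\<^sup>2"
      by (rule LIMSEQ_le) (use ineq in blast)
    then show "0 \<le> 2 * t * Re (hs_inner S z w - \<phi> w) + t\<^sup>2 * (N w)\<^sup>2" by simp
  qed
  have "\<phi> w = hs_inner S z w" if w: "w \<in> hs_carrier S" for w
  proof -
    \<comment> \<open>The identity of real parts at \<open>\<i>\<close> times \<open>w\<close>
      yields the imaginary parts at \<open>w\<close>.\<close>
    have "Re (hs_inner S z (hs_scale S \<i> w) - \<phi> (hs_scale S \<i> w)) = 0" using w by (intro Re_eq) auto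
    then have "Im (hs_inner S z w) = Im (\<phi> w)" using w z by (simp add: scale B_simps)
    then show ?thesis using Re_eq[OF w] by (simp add: complex_eq_iff)
  qed
  then show thesis using that z by blast
qed

text \<open>\<open>chs_adjoint\<close> is a choice, so the hypothesis of double commutation becomes
  usable once some adjoint is known to exist.\<close>

lemma adjoint_exists:
  assumes complete: "chs_complete S" and T: "chs_contraction S T"
  shows "chs_is_adjoint S T (chs_adjoint S T)"
proof -
  have TC: "T x \<in> hs_carrier S" if "x \<in> hs_carrier S" for x
    using T that by (simp add: chs_contraction_def hs_linear_def)
  have "\<exists>z\<in>hs_carrier S. \<forall>x\<in>hs_carrier S. hs_inner S y (T x) = hs_inner S z x" if y: "y \<in> hs_carrier S" for y
  proof -
    have "cmod (hs_inner S y (T x)) \<le> N y * N x" if x: "x \<in> hs_carrier S" for x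
    proof -
      have "N (T x) \<le> N x" using T x by (simp add: chs_contraction_def N_eq)
      then show ?thesis using cauchy_schwarz[OF y TC[OF x]] mult_left_mono[of "N (T x)" "N x" "N y"] y by fastforce
    qed
    then obtain z where "z \<in> hs_carrier S" "\<And>x. x \<in> hs_carrier S \<Longrightarrow> hs_inner S y (T x) = hs_inner S z x"
      using riesz[OF complete, of "\<lambda>x. hs_inner S y (T x)" "N y"] T y TC
      by (auto simp: chs_contraction_def hs_linear_def B_simps)
    then show ?thesis by blast
  qed
  then obtain A where A: "\<And>y. y \<in> hs_carrier S \<Longrightarrow> A y \<in> hs_carrier S"
    "\<And>x y. x \<in> hs_carrier S \<Longrightarrow> y \<in> hs_carrier S \<Longrightarrow> hs_inner S y (T x) = hs_inner S (A y) x"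
    by metis
  have "chs_is_adjoint S T A"
    unfolding chs_is_adjoint_def
  proof (intro conjI ballI A(1))
    fix x y assume x: "x \<in> hs_carrier S" and y: "y \<in> hs_carrier S"
    show "hs_inner S (T x) y = hs_inner S x (A y)"
      using hs_inner_herm[OF TC[OF x] y] hs_inner_herm[OF x A(1)[OF y]] A(2)[OF x y] by simp
  qed
  then show ?thesis unfolding chs_adjoint_def by (rule someI[of "chs_is_adjoint S T"])
qed

text \<open>Normalising \<open>x\<close> reduces to the unit ball. Contractivity settles
  \<open>N x = 0\<close> and bounds the set whose \<open>Sup\<close> is taken.\<close>

lemma N_le_opnorm:
  assumes T: "chs_contraction S T" and x: "x \<in> hs_carrier S"
  shows "N (T x) \<le> chs_opnorm S T * N x"
proof (cases "N x = 0")
  case True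
  have "N (T x) \<le> N x" using T x by (simp add: chs_contraction_def N_eq)
  then show ?thesis using True by simp
next
  case False
  then have pos: "0 < N x" using x by (simp add: less_le)
  define y where "y = hs_scale S (of_real (1 / N x)) x"
  have y: "y \<in> hs_carrier S" "N y = 1" using x pos by (simp_all add: y_def N_smul norm_divide)
  have TC: "T x \<in> hs_carrier S" using T x by (simp add: chs_contraction_def hs_linear_def)
  have "T y = hs_scale S (of_real (1 / N x)) (T x)"
    using T x unfolding y_def chs_contraction_def hs_linear_def by blast
  then have "N (T y) = N (T x) / N x" using TC pos by (simp add: N_smul norm_divide)
  moreover have "N (T y) \<le> chs_opnorm S T"
    unfolding chs_opnorm_def N_eq
  proof (rule cSup_upper)
    show "hs_norm S (T y) \<in> {hs_norm S (T x) |x. x \<in> hs_carrier S \<and> hs_norm S x \<le> 1}"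
      using y by (auto simp: N_eq)
    show "bdd_above {hs_norm S (T x) |x. x \<in> hs_carrier S \<and> hs_norm S x \<le> 1}"
      using T by (intro bdd_aboveI[of _ 1]) (fastforce simp: chs_contraction_def)
  qed
  ultimately have "N (T x) / N x \<le> chs_opnorm S T" by simp
  then show ?thesis using pos by (simp add: pos_divide_le_eq)
qed

end

text \<open>A first increase would persist: log-convexity keeps the ratio of consecutive terms at
  least \<open>a 1 / a 0\<close>, so the sequence would grow geometrically.\<close>

lemma log_convex_bounded:
  fixes a :: "nat \<Rightarrow> real"
  assumes nonneg: "\<And>k. 0 \<le> a k" and conv: "\<And>k. (a (Suc k))\<^sup>2 \<le> a k * a (Suc (Suc k))"
    and bounded: "\<And>k. a k \<le> M"
  shows "a 1 \<le> a 0"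
proof (rule ccontr)
  assume "\<not> a 1 \<le> a 0"
  then have gt: "a 0 < a 1" by simp
  have "a 0 \<noteq> 0" using conv[of 0] gt by auto
  then have pos: "0 < a 0" using nonneg[of 0] by linarith
  define r where "r = a 1 / a 0"
  have r: "1 < r" using gt pos by (simp add: r_def)
  have step: "0 < a k \<and> r * a k \<le> a (Suc k)" for k
  proof (induction k)
    case 0
    show ?case using pos by (simp add: r_def)
  next
    case (Suc k)
    then have p: "0 < a k" and le: "r * a k \<le> a (Suc k)" by auto
    have p': "0 < a (Suc k)" using p le r by (smt (verit) mult_pos_pos)
    have "r * a (Suc k) * a k \<le> a (Suc k) * a (Suc k)" using le p' by (simp add: mult.commute mult.left_commute)
    also have "\<dots> \<le> a (Suc (Suc k)) * a k" using conv[of k] by (simp add: power2_eq_square mult.commute)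
    finally show ?case using p p' by simp
  qed
  have "r ^ k * a 0 \<le> a k" for k
  proof (induction k)
    case (Suc k)
    have "r ^ Suc k * a 0 \<le> r * a k" using Suc r by simp
    then show ?case using step[of k] by linarith
  qed simp
  moreover obtain k where "M / a 0 < r ^ k" using real_arch_pow[OF r] by blast
  ultimately show False using bounded[of k] pos by (smt (verit) divide_less_eq)
qed

section \<open>Brehmer's condition in the three cases\<close>

context twisted_family
begin

text \<open>The form of \<open>S\<close> is invariant under every \<open>T a\<close> with
  \<open>a\<close> in \<open>L\<close>, so by \<open>Q_insert\<close> the forms of nonempty sets
  vanish; their invariance is in turn trivial, both sides being zero.\<close>

lemma brehmer_isometries:
  assumes iso: "\<And>a x. a \<in> L \<Longrightarrow> x \<in> C \<Longrightarrow> ip (T a x) (T a x) = ip x x"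
    and S: "finite S" "S \<subseteq> L" and x: "x \<in> C"
  shows "0 \<le> Re (Q S x x)"
proof -
  have inv: "Q S (T a x) (T a x) = Q S x x" if "finite S" "S \<subseteq> L" "a \<in> L" "x \<in> C" for S a x
    using that
  proof (induction S arbitrary: a x rule: finite_induct)
    case (insert b S)
    have "Q (insert b S) y y = 0" if "y \<in> C" for y
      using insert that by (simp add: Q_insert)
    then show ?case using insert by simp
  qed (simp add: iso)
  show ?thesis
  proof (cases "S = {}")
    case False
    then obtain b S' where S': "S = insert b S'" "b \<notin> S'" by (metis ex_in_conv mk_disjoint_insert)
    then show ?thesis using S x by (simp add: Q_insert inv)
  qed (simp add: hs_inner_nonneg x)
qed

text \<open>The lower bound alone does not pass through \<open>Q_insert\<close>: the subtracted term
  needs an upper bound at \<open>T a x\<close>, so both bounds are carried through the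
  induction.\<close>

lemma brehmer_row_contraction:
  assumes c: "\<And>a x. a \<in> L \<Longrightarrow> x \<in> C \<Longrightarrow> Re (ip (T a x) (T a x)) \<le> c a * Re (ip x x)"
    and sum: "\<And>S. finite S \<Longrightarrow> S \<subseteq> L \<Longrightarrow> sum c S \<le> 1"
    and S: "finite S" "S \<subseteq> L" and x: "x \<in> C"
  shows "0 \<le> Re (Q S x x)"
proof -
  have nn: "0 \<le> (1 - sum c S) * Re (ip x x)" if "finite S" "S \<subseteq> L" "x \<in> C" for S x
    using sum[OF that(1,2)] hs_inner_nonneg[OF that(3)] by simp
  have "(1 - sum c S) * Re (ip x x) \<le> Re (Q S x x) \<and> Re (Q S x x) \<le> Re (ip x x)"
    using S x
  proof (induction S arbitrary: x rule: finite_induct)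
    case (insert a S)
    have 1: "(1 - sum c S) * Re (ip x x) \<le> Re (Q S x x)" "Re (Q S x x) \<le> Re (ip x x)"
      using insert by auto
    have 2: "(1 - sum c S) * Re (ip (T a x) (T a x)) \<le> Re (Q S (T a x) (T a x))"
      "Re (Q S (T a x) (T a x)) \<le> Re (ip (T a x) (T a x))" using insert by auto
    have 3: "Re (ip (T a x) (T a x)) \<le> c a * Re (ip x x)" using c insert by simp
    have 4: "0 \<le> (1 - sum c S) * Re (ip (T a x) (T a x))" using nn[of S "T a x"] insert by simp
    have "Re (Q (insert a S) x x) = Re (Q S x x) - Re (Q S (T a x) (T a x))"
      using insert by (simp add: Q_insert)
    moreover have "sum c (insert a S) = c a + sum c S" using insert by simp
    ultimately show ?case using 1 2 3 4 by (simp add: algebra_simps)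
  qed simp
  then show ?thesis using nn[OF S x] by linarith
qed

lemma Tm_T:
  assumes x: "x \<in> C" shows "Tm v (T a x) = sc (cis (2 * s v {#a#})) (T a (Tm v x))"
proof -
  have "Tm v (T a x) = sc (cis (s v {#a#})) (Tm (add_mset a v) x)"
    using Tm_Tm[OF x, of v "{#a#}"] x by (simp add: Tm_single)
  moreover have "T a (Tm v x) = sc (cis (- s v {#a#})) (Tm (add_mset a v) x)"
    using T_Tm[OF x, of a v] s_antisym[of "{#a#}" v] by simp
  ultimately show ?thesis using x by (simp add: cis_mult)
qed

text \<open>By double commutation \<open>A a\<close> is an adjoint of \<open>T a\<close> also for
  the form of any \<open>S\<close> without \<open>a\<close>. Contractivity for that form then
  follows from Cauchy-Schwarz for it, together with its bound by \<open>ip\<close>, which the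
  induction therefore carries along.\<close>

lemma brehmer_doubly_commuting:
  assumes A_closed: "\<And>a x. a \<in> L \<Longrightarrow> x \<in> C \<Longrightarrow> A a x \<in> C"
    and adj: "\<And>a x y. a \<in> L \<Longrightarrow> x \<in> C \<Longrightarrow> y \<in> C \<Longrightarrow> ip (T a x) y = ip x (A a y)"
    and contr: "\<And>a x. a \<in> L \<Longrightarrow> x \<in> C \<Longrightarrow> N (T a x) \<le> N x"
    and doubly: "\<And>a b x. a \<in> L \<Longrightarrow> b \<in> L \<Longrightarrow> a \<noteq> b \<Longrightarrow> x \<in> C \<Longrightarrow>
      T b (A a x) = sc (cis (- (2 * \<sigma> b a))) (A a (T b x))"
    and S: "finite S" "S \<subseteq> L" and x: "x \<in> C"
  shows "0 \<le> Re (Q S x x)"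
proof -
  have A_sc: "A a (sc c y) = sc c (A a y)" if a: "a \<in> L" and y: "y \<in> C" for a c y
  proof (rule inner_eqI)
    fix z assume z: "z \<in> C"
    show "ip z (A a (sc c y)) = ip z (sc c (A a y))"
      using a y z A_closed by (simp add: adj[symmetric] ip_sc_right)
  qed (use a y A_closed in auto)
  have A_Tm: "Tm v (A a y) = sc (cis (- (2 * s v {#a#}))) (A a (Tm v y))"
    if a: "a \<in> L" and y: "y \<in> C" and v: "set_mset v \<subseteq> L - {a}" for a v y
    using v
  proof (induction v)
    case empty
    then show ?case using A_closed a y by simp
  next
    case (add b v)
    have b: "b \<in> L" "a \<noteq> b" using add by auto
    have "Tm (add_mset b v) (A a y) = sc (cis (- s {#b#} v)) (T b (sc (cis (- (2 * s v {#a#}))) (A a (Tm v y))))"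
      using add a y A_closed by (simp add: Tm_add_mset)
    also have "\<dots> = sc (cis (- s {#b#} v) * cis (- (2 * s v {#a#})) * cis (- (2 * \<sigma> b a))) (A a (T b (Tm v y)))"
      using a b y A_closed by (simp add: T_scale doubly mult.assoc)
    also have "\<dots> = sc (cis (- (2 * s (add_mset b v) {#a#}))) (A a (sc (cis (- s {#b#} v)) (T b (Tm v y))))"
      using a b y A_closed by (simp add: A_sc cis_mult mform_add_mset_left[of _ b v] mform_single algebra_simps)
    finally show ?case using y by (simp add: Tm_add_mset)
  qed
  have Q_adj: "Q S (T a x) y = Q S x (A a y)"
    if S: "finite S" "S \<subseteq> L" "a \<in> L" "a \<notin> S" and x: "x \<in> C" and y: "y \<in> C" for S a x y
    unfolding Q_def
  proof (intro sum.cong refl arg_cong2[where f="(*)"])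
    fix v assume v: "v \<in> Pow S"
    then have "finite v" using S finite_subset by auto
    then have v': "set_mset (mset_set v) \<subseteq> L - {a}" using v S by auto
    \<comment> \<open>Moving \<open>T a\<close> out on the left and \<open>A a\<close> out on the
      right produces the same phase, because conjugation in the left argument reverses the sign of
      the exponent.\<close>
    show "ip (Tm (mset_set v) (T a x)) (Tm (mset_set v) y) = ip (Tm (mset_set v) x) (Tm (mset_set v) (A a y))"
      using A_Tm[OF S(3) y v'] S(3) x y A_closed by (simp add: Tm_T ip_sc_left ip_sc_right cis_cnj adj)
  qed
  have N_A: "N (A a y) \<le> N y" if a: "a \<in> L" and y: "y \<in> C" for a y
  proof (cases "N (A a y) = 0")
    case False
    have AC: "A a y \<in> C" using A_closed a y by simp
    have "(N (A a y))\<^sup>2 = Re (ip (T a (A a y)) y)" using a y AC by (simp add: N_square adj)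
    also have "\<dots> \<le> N (T a (A a y)) * N y"
      using complex_Re_le_cmod cauchy_schwarz[of "T a (A a y)" y] AC y by (smt (verit) T_closed)
    also have "\<dots> \<le> N (A a y) * N y" using contr a AC y by (intro mult_right_mono) auto
    finally show ?thesis using False AC by (simp add: power2_eq_square less_le)
  qed (use y in simp)
  have "0 \<le> Re (Q S x x) \<and> Re (Q S x x) \<le> Re (ip x x)"
    using S x
  proof (induction S arbitrary: x rule: finite_induct)
    case empty
    then show ?case by (simp add: hs_inner_nonneg)
  next
    case (insert a S)
    have a: "a \<in> L" and S: "finite S" "S \<subseteq> L" "a \<notin> S" using insert by auto
    have IH: "0 \<le> Re (Q S y y)" "Re (Q S y y) \<le> Re (ip y y)" if "y \<in> C" for y
      using insert that by auto
    interpret q: semi_ip C "hs_add H" sc "Q S"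
      by unfold_locales (auto simp: Q_add_right Q_sc_right IH Q_herm[symmetric])
    txt \<open>Applying \<open>T a\<close> and its adjoint alternately yields a log-convex sequence of values of the
      form; since it is bounded, it cannot increase at the first step.\<close>
    define h where "h = rec_nat x (\<lambda>k y. if even k then T a y else A a y)"
    have h0: "h 0 = x" and hS: "h (Suc k) = (if even k then T a (h k) else A a (h k))" for k
      by (simp_all add: h_def)
    have hC: "h k \<in> C" for k by (induction k) (auto simp: h0 hS insert a A_closed)
    have hN: "N (h k) \<le> N x" for k
    proof (induction k)
      case (Suc k)
      have "N (h (Suc k)) \<le> N (h k)" using contr N_A a hC by (simp add: hS)
      then show ?case using Suc by linarith
    qed (simp add: h0)
    \<comment> \<open>Adjointness moves one step from one argument to the other; with Cauchy-Schwarz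
      this is the log-convexity of the values \<open>Q S (h k) (h k)\<close>.\<close>
    have shift: "Q S (h (Suc k)) (h (Suc k)) = Q S (h k) (h (Suc (Suc k)))" for k
    proof (cases "even k")
      case True
      then show ?thesis using Q_adj[OF S(1,2) a S(3) hC hC, of k "Suc k"] by (simp add: hS)
    next
      case False
      have "Q S (h (Suc k)) (h (Suc k)) = Q S (h (Suc k)) (A a (h k))" using False by (simp add: hS)
      also have "\<dots> = Q S (T a (h (Suc k))) (h k)" by (rule Q_adj[OF S(1,2) a S(3) hC hC, symmetric])
      also have "\<dots> = Q S (h (Suc (Suc k))) (h k)" using False by (simp add: hS[of "Suc k"])
      finally have "Q S (h (Suc k)) (h (Suc k)) = Q S (h (Suc (Suc k))) (h k)" .
      then show ?thesis
        using Q_herm[OF hC hC, of S k "Suc (Suc k)"] Q_herm[OF hC hC, of S "Suc k" "Suc k"] by (metis)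
    qed
    have "Re (Q S (h 1) (h 1)) \<le> Re (Q S (h 0) (h 0))"
    proof (rule log_convex_bounded)
      fix k
      show "0 \<le> Re (Q S (h k) (h k))" by (rule IH[OF hC])
      show "Re (Q S (h k) (h k)) \<le> (N x)\<^sup>2"
        using IH(2)[OF hC, of k] power_mono[OF hN[of k], of 2] hC by (simp add: N_square)
      have "(Re (Q S (h (Suc k)) (h (Suc k))))\<^sup>2 \<le> (cmod (Q S (h k) (h (Suc (Suc k)))))\<^sup>2"
        unfolding shift by (simp add: cmod_power2)
      also have "\<dots> \<le> Re (Q S (h k) (h k)) * Re (Q S (h (Suc (Suc k))) (h (Suc (Suc k))))"
        by (rule q.cauchy_schwarz_sq[OF hC hC])
      finally show "(Re (Q S (h (Suc k)) (h (Suc k))))\<^sup>2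
        \<le> Re (Q S (h k) (h k)) * Re (Q S (h (Suc (Suc k))) (h (Suc (Suc k))))" .
    qed
    then have le: "Re (Q S (T a x) (T a x)) \<le> Re (Q S x x)" by (simp add: hS h0)
    have Tx: "T a x \<in> C" and xC: "x \<in> C" using insert by auto
    have "Q (insert a S) x x = Q S x x - Q S (T a x) (T a x)" using S xC by (simp add: Q_insert)
    then show ?case using le IH[OF xC] IH[OF Tx] by simp
  qed
  then show ?thesis ..
qed

lemma Q_restrict:
  assumes zero: "\<And>a x. a \<notin> L \<Longrightarrow> x \<in> C \<Longrightarrow> T a x = hs_zero H"
    and "finite S" and x: "x \<in> C"
  shows "Q S x x = Q (S \<inter> L) x x"
  using \<open>finite S\<close> x
proof (induction S arbitrary: x rule: finite_induct)
  case (insert a S)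
  show ?case
  proof (cases "a \<in> L")
    case True
    then show ?thesis using insert by (simp add: Q_insert)
  next
    case False
    then show ?thesis using insert zero by (simp add: Q_insert Q_zero_left)
  qed
qed simp

end

text \<open>Taking \<open>Arg (q a b) / 2\<close> for both orders of a pair fails to be
  antisymmetric at \<open>q a b = -1\<close>, where both arguments are pi. A well-order on the
  letters selects one order of each pair; the other receives the negative.\<close>

lemma ex_phases:
  fixes q :: "'i \<Rightarrow> 'i \<Rightarrow> complex"
  assumes circ: "\<And>a b. a \<in> L \<Longrightarrow> b \<in> L \<Longrightarrow> a \<noteq> b \<Longrightarrow> cmod (q a b) = 1"
    and inv: "\<And>a b. a \<in> L \<Longrightarrow> b \<in> L \<Longrightarrow> a \<noteq> b \<Longrightarrow> q a b = inverse (q b a)"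
  obtains \<sigma> :: "'i \<Rightarrow> 'i \<Rightarrow> real" where "\<And>a b. \<sigma> a b = - \<sigma> b a"
    and "\<And>a b. a \<in> L \<Longrightarrow> b \<in> L \<Longrightarrow> a \<noteq> b \<Longrightarrow> cis (2 * \<sigma> a b) = q a b"
proof -
  obtain r :: "'i rel" where r: "well_order_on UNIV r" using well_order_on by blast
  then have total: "(a, b) \<in> r \<or> (b, a) \<in> r" if "a \<noteq> b" for a b
    using that by (auto simp: well_order_on_def linear_order_on_def total_on_def)
  have antisym: "a = b" if "(a, b) \<in> r" "(b, a) \<in> r" for a b
    using r that by (auto simp: well_order_on_def linear_order_on_def partial_order_on_def antisym_def)
  define \<sigma> where "\<sigma> a b = (if a = b then 0 else if (a, b) \<in> r then Arg (q a b) / 2 else - Arg (q b a) / 2)" for a b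
  have cis_Arg': "cis (Arg (q a b)) = q a b" if "a \<in> L" "b \<in> L" "a \<noteq> b" for a b
  proof -
    have "q a b \<noteq> 0" using circ[OF that] by auto
    then show ?thesis using circ[OF that] by (simp add: cis_Arg sgn_div_norm)
  qed
  show thesis
  proof (rule that)
    show "\<sigma> a b = - \<sigma> b a" for a b using total antisym by (auto simp: \<sigma>_def)
    show "cis (2 * \<sigma> a b) = q a b" if ab: "a \<in> L" "b \<in> L" "a \<noteq> b" for a b
    proof (cases "(a, b) \<in> r")
      case True
      then show ?thesis using ab cis_Arg'[OF ab] by (simp add: \<sigma>_def)
    next
      case False
      have "cis (- Arg (q b a)) = inverse (cis (Arg (q b a)))" by simp
      also have "\<dots> = q a b" using cis_Arg'[of b a] inv[OF ab] ab by simp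
      finally show ?thesis using False ab by (simp add: \<sigma>_def)
    qed
  qed
qed

theorem theorem5p2:
  fixes H :: "'h chs" and L :: "'i set" and q :: "'i \<Rightarrow> 'i \<Rightarrow> complex"
    and T :: "'i \<Rightarrow> 'h \<Rightarrow> 'h"
  assumes hilb: "chs_hilbert H"
    and q_circ: "\<forall>a\<in>L. \<forall>b\<in>L. a \<noteq> b \<longrightarrow> cmod (q a b) = 1"
    and q_inv: "\<forall>a\<in>L. \<forall>b\<in>L. a \<noteq> b \<longrightarrow> q a b = inverse (q b a)"
    and contr: "\<forall>a\<in>L. chs_contraction H (T a)"
    and qcomm: "\<forall>a\<in>L. \<forall>b\<in>L. a \<noteq> b \<longrightarrow>
                  (\<forall>x\<in>hs_carrier H. T a (T b x) = hs_scale H (q a b) (T b (T a x)))"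
    and cases: "(\<forall>a\<in>L. chs_isometry H (T a))
             \<or> (\<forall>a\<in>L. \<forall>b\<in>L. a \<noteq> b \<longrightarrow>
                  (\<forall>x\<in>hs_carrier H. T a (chs_adjoint H (T b) x)
                        = hs_scale H (cnj (q a b)) (chs_adjoint H (T b) (T a x))))
             \<or> (countable L \<and> (\<lambda>a. (chs_opnorm H (T a))\<^sup>2) summable_on L
                  \<and> (\<Sum>\<^sub>\<infinity>a\<in>L. (chs_opnorm H (T a))\<^sup>2) \<le> 1)"
  shows "\<exists>(K :: (nat \<Rightarrow> ('i \<times> int) list \<times> 'h) chs) J U.
           chs_hilbert K \<and> hs_embedding H K J \<and>
           (\<forall>a\<in>L. chs_unitary K (U a)) \<and>
           (\<forall>a\<in>L. \<forall>b\<in>L. a \<noteq> b \<longrightarrow>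
              (\<forall>y\<in>hs_carrier K. U a (U b y) = hs_scale K (q a b) (U b (U a y)))) \<and>
           (\<forall>ws. distinct (map fst ws) \<and> set (map fst ws) \<subseteq> L \<longrightarrow>
              (\<forall>x\<in>hs_carrier H.
                 J (word_op T ws x) = orth_proj K (J ` hs_carrier H) (word_op U ws (J x))))"
proof -
  have sp: "inner_space H" and complete: "chs_complete H" using hilb by (simp_all add: chs_hilbert_iff)
  interpret H: inner_space H by (rule sp)
  obtain \<sigma> :: "'i \<Rightarrow> 'i \<Rightarrow> real" where antisym: "\<And>a b. \<sigma> a b = - \<sigma> b a"
    and \<sigma>_q: "\<And>a b. a \<in> L \<Longrightarrow> b \<in> L \<Longrightarrow> a \<noteq> b \<Longrightarrow> cis (2 * \<sigma> a b) = q a b"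
    using ex_phases[of L q] q_circ q_inv by metis
  txt \<open>Extension by zero preserves the commutation relations for letters outside \<open>L\<close> and reduces
    every defect form to one over \<open>L\<close>.\<close>
  define T' where "T' a x = (if a \<in> L then T a x else hs_zero H)" for a x
  have lin: "T a x \<in> hs_carrier H" "T a (hs_add H x y) = hs_add H (T a x) (T a y)"
    "T a (hs_scale H c x) = hs_scale H c (T a x)"
    if "a \<in> L" "x \<in> hs_carrier H" "y \<in> hs_carrier H" for a x y c
    using contr that by (simp_all add: chs_contraction_def hs_linear_def)
  have T_zero: "T a (hs_zero H) = hs_zero H" if "a \<in> L" for a
    using lin(3)[OF that H.zero_closed H.zero_closed, of 0] lin(1)[OF that H.zero_closed H.zero_closed]
    by (simp add: H.scale_zero_left)
  have comm: "T' a (T' b x) = hs_scale H (cis (2 * \<sigma> a b)) (T' b (T' a x))" if x: "x \<in> hs_carrier H" for a b x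
  proof (cases "a \<in> L \<and> b \<in> L \<and> a \<noteq> b")
    case True
    then show ?thesis using qcomm \<sigma>_q[of a b] x by (simp add: T'_def)
  next
    case False
    \<comment> \<open>Either \<open>a = b\<close> and the factor is 1, or one of the letters lies
      outside \<open>L\<close> and both sides are zero.\<close>
    have "\<sigma> a a = 0" using antisym[of a a] by linarith
    then show ?thesis using False lin x T_zero by (auto simp: T'_def)
  qed
  interpret twisted_family H T' \<sigma>
  proof
    show "\<sigma> a b = - \<sigma> b a" for a b by (rule antisym)
    show "T' a (T' b x) = hs_scale H (cis (2 * \<sigma> a b)) (T' b (T' a x))" if "x \<in> hs_carrier H" for a b x
      by (rule comm[OF that])
  qed (auto simp: T'_def lin)
  have brehmer_L: "0 \<le> Re (Q S x x)" if S: "finite S" "S \<subseteq> L" and x: "x \<in> C" for S x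
    using cases
  proof (elim disjE conjE)
    assume iso: "\<forall>a\<in>L. chs_isometry H (T a)"
    show ?thesis
    proof (rule brehmer_isometries[OF _ S x])
      fix a x assume a: "a \<in> L" and x: "x \<in> C"
      have "H.N (T a x) = H.N x" using iso a x by (simp add: chs_isometry_def H.N_eq)
      then have "Re (ip (T' a x) (T' a x)) = Re (ip x x)"
        using a x lin(1)[OF a x x] by (simp add: T'_def flip: H.N_square)
      \<comment> \<open>Isometry is given through norms, that is, real parts; diagonal values are
        real, so the complex numbers agree.\<close>
      then show "ip (T' a x) (T' a x) = ip x x" using H.B_self x T_closed by metis
    qed
  next
    assume doubly: "\<forall>a\<in>L. \<forall>b\<in>L. a \<noteq> b \<longrightarrow> (\<forall>x\<in>C. T a (chs_adjoint H (T b) x)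
                        = sc (cnj (q a b)) (chs_adjoint H (T b) (T a x)))"
    have adj: "chs_is_adjoint H (T a) (chs_adjoint H (T a))" if "a \<in> L" for a
      using H.adjoint_exists[OF complete] contr that by blast
    show ?thesis
    proof (rule brehmer_doubly_commuting[where A = "\<lambda>a. chs_adjoint H (T a)", OF _ _ _ _ S x])
      fix a assume a: "a \<in> L"
      show "chs_adjoint H (T a) x \<in> C" if "x \<in> C" for x
        using adj[OF a] that by (simp add: chs_is_adjoint_def)
      show "ip (T' a x) y = ip x (chs_adjoint H (T a) y)" if "x \<in> C" "y \<in> C" for x y
        using adj[OF a] that a by (simp add: chs_is_adjoint_def T'_def)
      show "H.N (T' a x) \<le> H.N x" if "x \<in> C" for x
        using contr a that by (simp add: T'_def chs_contraction_def H.N_eq)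
      show "T' b (chs_adjoint H (T a) x) = sc (cis (- (2 * \<sigma> b a))) (chs_adjoint H (T a) (T' b x))"
        if "b \<in> L" "a \<noteq> b" "x \<in> C" for b x
      proof -
        have "cnj (q b a) = cis (- (2 * \<sigma> b a))" using \<sigma>_q[of b a] that a by (simp flip: cis_cnj)
        then show ?thesis using doubly that a by (simp add: T'_def)
      qed
    qed
  next
    let ?c = "\<lambda>a. (chs_opnorm H (T a))\<^sup>2"
    assume summable: "?c summable_on L" and le: "infsum ?c L \<le> 1"
    show ?thesis
    proof (rule brehmer_row_contraction[where c = ?c, OF _ _ S x])
      fix a x assume a: "a \<in> L" and x: "x \<in> C"
      have "H.N (T a x) \<le> chs_opnorm H (T a) * H.N x" using H.N_le_opnorm contr a x by blast
      then have "(H.N (T a x))\<^sup>2 \<le> (chs_opnorm H (T a) * H.N x)\<^sup>2"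
        using lin(1)[OF a x x] by (intro power_mono) auto
      then show "Re (ip (T' a x) (T' a x)) \<le> ?c a * Re (ip x x)"
        using a x lin(1)[OF a x x] by (simp add: T'_def power_mult_distrib flip: H.N_square)
    next
      fix S assume "finite S" "S \<subseteq> L"
      then have "sum ?c S \<le> infsum ?c L" using summable by (intro finite_sum_le_infsum) auto
      then show "sum ?c S \<le> 1" using le by linarith
    qed
  qed
  interpret brehmer_family H T' \<sigma>
  proof
    show "0 \<le> Re (Q S x x)" if "finite S" "x \<in> C" for S x
      using Q_restrict[of L S x] brehmer_L[of "S \<inter> L" x] that by (simp add: T'_def)
  qed
  obtain K :: "(nat \<Rightarrow> ('i \<times> int) list \<times> 'h) chs" and J U
    where K: "chs_hilbert K" "hs_embedding H K J" and U: "\<And>a. chs_unitary K (U a)"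
      and UU: "\<And>a b y. y \<in> hs_carrier K \<Longrightarrow> U a (U b y) = hs_scale K (cis (2 * \<sigma> a b)) (U b (U a y))"
      and dil: "\<And>ws x. x \<in> C \<Longrightarrow> J (word_op T' ws x) = orth_proj K (J ` C) (word_op U ws (J x))"
    using ex_unitary_dilation by blast
  have T'_T: "word_op T' ws = word_op T ws" if "set (map fst ws) \<subseteq> L" for ws
    using that
  proof (induction ws)
    case (Cons w ws)
    have "T' (fst w) = T (fst w)" using Cons(2) by (auto simp: T'_def)
    then show ?case using Cons by (cases w) (simp add: word_op_def)
  qed (simp add: word_op_def)
  show ?thesis
  proof (rule exI[of _ K], rule exI[of _ J], rule exI[of _ U], intro conjI allI ballI impI K U)
    show "U a (U b y) = hs_scale K (q a b) (U b (U a y))"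
      if "a \<in> L" "b \<in> L" "a \<noteq> b" "y \<in> hs_carrier K" for a b y
      using UU[OF that(4), of a b] \<sigma>_q[OF that(1-3)] by simp
    show "J (word_op T ws x) = orth_proj K (J ` C) (word_op U ws (J x))"
      if "distinct (map fst ws) \<and> set (map fst ws) \<subseteq> L" "x \<in> C" for ws x
      using dil[OF that(2), of ws] T'_T that(1) by simp
  qed
qed

end
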